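(* Let $\mathcal{X}$, $D_{\mathcal{X}}$, $(x_n)_{n\in\mathbb{N}}$, $N$, $q$, $\varphi$, $\varphi_t$, $B_t$, $W$, the Taylor or radial kernel $k_W$ with its function $K$ and constant $C_{K'}$, and the kernels $k,k_t$ on $\mathcal{X}$ with RKHSs $H,H_t$ be as in the context. Let $\varepsilon>0$ and $f\in\mathcal{C}(\mathcal{X})$, and let $h[\varepsilon,f]$ be the (unique) minimiser of $\|h\|_H^2$ over $\{h\in H:\|h-f\|_\infty\le\varepsilon\}$. Then there exists $h_t\in H_t$ such that $$\|f-h_t\|_\infty\le\varepsilon+\rho_t\,\|h[\varepsilon,f]\|_H,$$ where $\rho_t=q^{-N/2}D_{\mathcal{X}}\sqrt{2C_{K'}}$ if $k_W$ is a Taylor kernel and $\rho_t=q^{-N}D_{\mathcal{X}}\sqrt{2C_{K'}}$ if $k_W$ is a radial kernel.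
   Context: Notation: $\mathbb{N}$ includes $0$; $\ell^2$ is the Hilbert space of real square-summable sequences indexed by $\mathbb{N}$; $\mathcal{C}(\mathcal{X})$ is the space of continuous functions $\mathcal{X}\to\mathbb{R}$ with supremum norm $\|\cdot\|_\infty$; the RKHS of a kernel (symmetric positive semi-definite function) $k$ on a set $E$ is the unique Hilbert space $H$ of functions $E\to\mathbb{R}$ containing all $k(\cdot,x)$ and satisfying $\langle h,k(\cdot,x)\rangle_H=h(x)$. Setting: $(\mathcal{X},d_{\mathcal{X}})$ is a non-empty compact metric space with diameter $D_{\mathcal{X}}>0$; $(x_n)_{n\in\mathbb{N}}$ is a basis of $\mathcal{X}$ (a sequence of points of $\mathcal{X}$ such that every $x\in\mathcal{X}$ is within distance $\varepsilon$ of some $x_n$, for every $\varepsilon>0$); $N\ge2$ is an integer and $q>1$. Maps: with $c_\varphi=\sqrt{q^2-1}/q$, $\varphi:\mathcal{X}\to\ell^2$, $\varphi(x)=\left(c_\varphi d_{\mathcal{X}}(x,x_n)/q^n\right)_{n\in\mathbb{N}}$; $\varphi_t:\mathcal{X}\to\mathbb{R}^N$, $\varphi_t(x)=\left(c_\varphi d_{\mathcal{X}}(x,x_n)/q^n\right)_{n=0}^{N-1}$; $B_t:\mathbb{R}^N\to\ell^2$, $B_t(u_0,\dots,u_{N-1})=(u_0,\dots,u_{N-1},0,0,\dots)$. Let $W:=\varphi(\mathcal{X})\cup B_t(\varphi_t(\mathcal{X}))$, a compact subset of $\ell^2$. Kernel on $W$: $k_W:W^2\to\mathbb{R}$ is one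 of the following. - Taylor kernel: $k_W(u,v)=K(\langle u,v\rangle_{\ell^2})$ with $K(t)=\sum_{n\ge0}a_nt^n$, all $a_n>0$, where the series converges absolutely and $K$ is continuously differentiable on $[-4D_{\mathcal{X}}^2,4D_{\mathcal{X}}^2]$ (one-sided derivatives at the endpoints); $C_{K'}:=\max_{t\in[-4D_{\mathcal{X}}^2,4D_{\mathcal{X}}^2]}|K'(t)|$. - Radial kernel: $k_W(u,v)=K(\|u-v\|_{\ell^2}^2)$ with $K(t)=\int_0^{+\infty}e^{-st}\,\mathrm{d}\mu(s)$ for $t\ge0$, where $\mu$ is a finite Borel measure on $[0,+\infty)$ with $\mathrm{supp}(\mu)\not\subset\{0\}$ and $K$ is continuously differentiable on $[0,4D_{\mathcal{X}}^2]$ (right derivative at $0$); $C_{K'}:=\max_{t\in[0,4D_{\mathcal{X}}^2]}|K'(t)|$. Kernels on $\mathcal{X}$: $k(x,y):=k_W(\varphi(x),\varphi(y))$ with RKHS $H$, and $k_t(x,y):=k_W(B_t\circ\varphi_t(x),B_t\circ\varphi_t(y))$ with RKHS $H_t$. *)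

theory Defs
  imports "HOL-Analysis.Analysis"
begin

(* Real sequences, finite or not, are functions of type nat => real; an element of R^N is one that
   is extensional on {..<N}.  The inner product is meaningful only for members of ell2. *)

definition ell2 :: "(nat \<Rightarrow> real) set" where
  "ell2 = {u. summable (\<lambda>n. (u n)\<^sup>2)}"

definition ell2_inner :: "(nat \<Rightarrow> real) \<Rightarrow> (nat \<Rightarrow> real) \<Rightarrow> real" where
  "ell2_inner u v = (\<Sum>n. u n * v n)"

definition ell2_norm :: "(nat \<Rightarrow> real) \<Rightarrow> real" where
  "ell2_norm u = sqrt (ell2_inner u u)"

definition is_basis :: "'a::metric_space set \<Rightarrow> (nat \<Rightarrow> 'a) \<Rightarrow> bool" where
  "is_basis X xs \<longleftrightarrow> range xs \<subseteq> X \<and> (\<forall>x\<in>X. \<forall>\<epsilon>>0. \<exists>n. dist x (xs n) \<le> \<epsilon>)"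

definition c_phi :: "real \<Rightarrow> real" where
  "c_phi q = sqrt (q\<^sup>2 - 1) / q"

definition phi :: "real \<Rightarrow> (nat \<Rightarrow> 'a::metric_space) \<Rightarrow> 'a \<Rightarrow> (nat \<Rightarrow> real)" where
  "phi q xs x = (\<lambda>n. c_phi q * dist x (xs n) / q ^ n)"

definition phi_trunc ::
  "real \<Rightarrow> (nat \<Rightarrow> 'a::metric_space) \<Rightarrow> nat \<Rightarrow> 'a \<Rightarrow> (nat \<Rightarrow> real)" where
  "phi_trunc q xs N x = (\<lambda>n\<in>{..<N}. c_phi q * dist x (xs n) / q ^ n)"

definition pad :: "nat \<Rightarrow> (nat \<Rightarrow> real) \<Rightarrow> (nat \<Rightarrow> real)" where
  "pad N u = (\<lambda>n. if n < N then u n else 0)"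

definition W_set ::
  "'a::metric_space set \<Rightarrow> real \<Rightarrow> (nat \<Rightarrow> 'a) \<Rightarrow> nat \<Rightarrow> (nat \<Rightarrow> real) set" where
  "W_set X q xs N = phi q xs ` X \<union> pad N ` (phi_trunc q xs N ` X)"

lemma W_set_subset_ell2:
  fixes X :: "'a::metric_space set"
  assumes "bounded X" "range xs \<subseteq> X" "q > 1"
  shows "W_set X q xs N \<subseteq> ell2"
proof -
  have "phi q xs x \<in> ell2" if "x \<in> X" for x
  proof -
    have r: "norm (1 / q\<^sup>2) < 1"
    proof -
      have "1 < q\<^sup>2"
        using assms(3) by (intro one_less_power) auto
      then have "1 / q\<^sup>2 < 1"
        by (subst divide_less_eq_1_pos) linarith+
      then show ?thesis
        by simp
    qed
    have sm: "summable (\<lambda>n. (c_phi q * diameter X)\<^sup>2 * (1 / q\<^sup>2) ^ n)"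
      using summable_mult[OF summable_geometric[OF r]] .
    have le: "norm ((phi q xs x n)\<^sup>2) \<le> (c_phi q * diameter X)\<^sup>2 * (1 / q\<^sup>2) ^ n" for n
    proof -
      have "dist x (xs n) \<le> diameter X"
        using assms that by (intro diameter_bounded_bound) auto
      then have "(dist x (xs n))\<^sup>2 \<le> (diameter X)\<^sup>2"
        by (intro power_mono) auto
      then have "(c_phi q)\<^sup>2 * (dist x (xs n))\<^sup>2 \<le> (c_phi q)\<^sup>2 * (diameter X)\<^sup>2"
        by (intro mult_left_mono) auto
      then have "(c_phi q)\<^sup>2 * (dist x (xs n))\<^sup>2 / (q ^ n)\<^sup>2
          \<le> (c_phi q)\<^sup>2 * (diameter X)\<^sup>2 / (q ^ n)\<^sup>2"
        by (intro divide_right_mono) auto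
      moreover have "(phi q xs x n)\<^sup>2 = (c_phi q)\<^sup>2 * (dist x (xs n))\<^sup>2 / (q ^ n)\<^sup>2"
        by (simp only: phi_def power_mult_distrib power_divide)
      moreover have "(q ^ n)\<^sup>2 = (q\<^sup>2) ^ n"
        by (simp only: power2_eq_square power_mult_distrib)
      then have "(c_phi q * diameter X)\<^sup>2 * (1 / q\<^sup>2) ^ n
          = (c_phi q)\<^sup>2 * (diameter X)\<^sup>2 / (q ^ n)\<^sup>2"
        by (simp only: power_mult_distrib power_one_over) simp
      moreover have "norm ((phi q xs x n)\<^sup>2) = (phi q xs x n)\<^sup>2"
        by simp
      ultimately show ?thesis
        by linarith
    qed
    have "summable (\<lambda>n. (phi q xs x n)\<^sup>2)"
      by (rule summable_comparison_test'[OF sm le])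
    then show ?thesis
      by (simp add: ell2_def)
  qed
  moreover have "pad N u \<in> ell2" for u
  proof -
    have "summable (\<lambda>n. (pad N u n)\<^sup>2)"
      by (rule summable_finite[of "{..<N}"]) (auto simp: pad_def)
    then show ?thesis
      by (simp add: ell2_def)
  qed
  ultimately show ?thesis
    by (auto simp: W_set_def)
qed

(* Derivatives are taken within I, hence one-sided at the endpoints of an interval; the library's
   C1_differentiable_on asks for two-sided derivatives there. *)

definition C1_on :: "real set \<Rightarrow> (real \<Rightarrow> real) \<Rightarrow> bool" where
  "C1_on I K \<longleftrightarrow> K differentiable_on I
     \<and> continuous_on I (\<lambda>t. vector_derivative K (at t within I))"

(* For I compact and nonempty and C1_on I K the supremum is attained. *)

definition max_abs_deriv :: "real set \<Rightarrow> (real \<Rightarrow> real) \<Rightarrow> real" where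
  "max_abs_deriv I K = (SUP t\<in>I. \<bar>vector_derivative K (at t within I)\<bar>)"

abbreviation taylor_interval :: "real \<Rightarrow> real set" where
  "taylor_interval D \<equiv> {- 4 * D\<^sup>2 .. 4 * D\<^sup>2}"

abbreviation radial_interval :: "real \<Rightarrow> real set" where
  "radial_interval D \<equiv> {0 .. 4 * D\<^sup>2}"

definition taylor_kernel ::
  "real \<Rightarrow> (nat \<Rightarrow> real) set \<Rightarrow> (real \<Rightarrow> real) \<Rightarrow> ((nat \<Rightarrow> real) \<Rightarrow> (nat \<Rightarrow> real) \<Rightarrow> real) \<Rightarrow> bool" where
  "taylor_kernel D W K kW \<longleftrightarrow>
     (\<exists>a :: nat \<Rightarrow> real. (\<forall>n. a n > 0)
        \<and> (\<forall>t\<in>taylor_interval D. summable (\<lambda>n. \<bar>a n * t ^ n\<bar>) \<and> K t = (\<Sum>n. a n * t ^ n)))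
     \<and> C1_on (taylor_interval D) K
     \<and> (\<forall>u\<in>W. \<forall>v\<in>W. kW u v = K (ell2_inner u v))"

definition measure_support :: "real measure \<Rightarrow> real set" where
  "measure_support \<mu> =
     {s \<in> space \<mu>. \<forall>U. open U \<and> s \<in> U \<longrightarrow> emeasure \<mu> (U \<inter> space \<mu>) > 0}"

definition radial_kernel ::
  "real \<Rightarrow> (nat \<Rightarrow> real) set \<Rightarrow> (real \<Rightarrow> real) \<Rightarrow> ((nat \<Rightarrow> real) \<Rightarrow> (nat \<Rightarrow> real) \<Rightarrow> real) \<Rightarrow> bool" where
  "radial_kernel D W K kW \<longleftrightarrow>
     (\<exists>\<mu>. finite_measure \<mu> \<and> sets \<mu> = sets (restrict_space borel {0..})
        \<and> \<not> measure_support \<mu> \<subseteq> {0}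
        \<and> (\<forall>t\<ge>0. K t = (\<integral>s. exp (- s * t) \<partial>\<mu>)))
     \<and> C1_on (radial_interval D) K
     \<and> (\<forall>u\<in>W. \<forall>v\<in>W. kW u v = K ((ell2_norm (\<lambda>n. u n - v n))\<^sup>2))"

(* A Hilbert space of functions E -> R is given by its carrier H and its inner product ip, which is
   only relevant on H.  Functions on E are extensional, so that equality means equality on E. *)

definition hs_norm :: "(('a \<Rightarrow> real) \<Rightarrow> ('a \<Rightarrow> real) \<Rightarrow> real) \<Rightarrow> ('a \<Rightarrow> real) \<Rightarrow> real" where
  "hs_norm ip h = sqrt (ip h h)"

definition function_hilbert_space ::
  "'a set \<Rightarrow> ('a \<Rightarrow> real) set \<Rightarrow> (('a \<Rightarrow> real) \<Rightarrow> ('a \<Rightarrow> real) \<Rightarrow> real) \<Rightarrow> bool" where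
  "function_hilbert_space E H ip \<longleftrightarrow>
     H \<subseteq> E \<rightarrow>\<^sub>E UNIV
     \<and> (\<lambda>x\<in>E. 0) \<in> H
     \<and> (\<forall>g\<in>H. \<forall>h\<in>H. (\<lambda>x\<in>E. g x + h x) \<in> H)
     \<and> (\<forall>c. \<forall>h\<in>H. (\<lambda>x\<in>E. c * h x) \<in> H)
     \<and> (\<forall>g\<in>H. \<forall>h\<in>H. ip g h = ip h g)
     \<and> (\<forall>f\<in>H. \<forall>g\<in>H. \<forall>h\<in>H. ip (\<lambda>x\<in>E. f x + g x) h = ip f h + ip g h)
     \<and> (\<forall>c. \<forall>g\<in>H. \<forall>h\<in>H. ip (\<lambda>x\<in>E. c * g x) h = c * ip g h)
     \<and> (\<forall>h\<in>H. ip h h \<ge> 0)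
     \<and> (\<forall>h\<in>H. ip h h = 0 \<longrightarrow> h = (\<lambda>x\<in>E. 0))
     \<and> Metric_space.mcomplete H (\<lambda>g h. hs_norm ip (\<lambda>x\<in>E. g x - h x))"

definition is_RKHS ::
  "'a set \<Rightarrow> ('a \<Rightarrow> 'a \<Rightarrow> real) \<Rightarrow> ('a \<Rightarrow> real) set
     \<Rightarrow> (('a \<Rightarrow> real) \<Rightarrow> ('a \<Rightarrow> real) \<Rightarrow> real) \<Rightarrow> bool" where
  "is_RKHS E k H ip \<longleftrightarrow> function_hilbert_space E H ip
     \<and> (\<forall>x\<in>E. (\<lambda>y\<in>E. k y x) \<in> H \<and> (\<forall>h\<in>H. ip h (\<lambda>y\<in>E. k y x) = h x))"

definition sup_norm :: "'a set \<Rightarrow> ('a \<Rightarrow> real) \<Rightarrow> real" where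
  "sup_norm X g = (SUP x\<in>X. \<bar>g x\<bar>)"

end

(* Finite combinations of kernel sections suffice. Bounded by its RKHS norm on such combinations, h is
   uniformly approximated by a combination of sections of k_W of almost the same norm; evaluating it on
   the truncated features instead changes it by at most ||h|| times the feature distance in the RKHS of
   k_W, and the result is in turn approximated uniformly from the span of the sections of k_t. The
   feature distance is strictly below rho_t, for the radial kernel by strict convexity of K, and this
   slack absorbs the approximation errors. Completeness of the RKHSs is never used; this matters because
   Metric_space.mcomplete has no usable definition for a distance that, like the one here, is
   unconstrained outside the carrier. *)

theory Submission imports Defs begin

section \<open>Positive semi-definite kernels and their forms on formal combinations\<close>

text \<open>The points of the family may repeat, so the property pulls back along feature maps that
  are not injective.\<close>

definition psd_on :: "'b set \<Rightarrow> ('b \<Rightarrow> 'b \<Rightarrow> real) \<Rightarrow> bool" where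
  "psd_on W k \<longleftrightarrow> (\<forall>u\<in>W. \<forall>v\<in>W. k u v = k v u) \<and>
     (\<forall>(n::nat) c x. (\<forall>i<n. x i \<in> W) \<longrightarrow> 0 \<le> (\<Sum>i<n. \<Sum>j<n. c i * c j * k (x i) (x j)))"

lemma psd_onD:
  "psd_on W k \<Longrightarrow> (\<And>i::nat. i < n \<Longrightarrow> x i \<in> W) \<Longrightarrow> 0 \<le> (\<Sum>i<n. \<Sum>j<n. c i * c j * k (x i) (x j))"
  unfolding psd_on_def by blast

text \<open>A list of coefficient-point pairs stands for a formal combination of kernel sections:
  addition is append, scaling is a map, and no quotient by null combinations is taken. This is the
  inner product of two such combinations in the pre-Hilbert space of \<open>k\<close>.\<close>

definition kform :: "('b \<Rightarrow> 'b \<Rightarrow> real) \<Rightarrow> (real \<times> 'b) list \<Rightarrow> (real \<times> 'b) list \<Rightarrow> real" where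
  "kform k l m = (\<Sum>(c, u)\<leftarrow>l. \<Sum>(d, v)\<leftarrow>m. c * d * k u v)"

definition scale :: "real \<Rightarrow> (real \<times> 'b) list \<Rightarrow> (real \<times> 'b) list" where
  "scale t = map (\<lambda>(c, u). (t * c, u))"

text \<open>This is the linear functional on formal combinations that sends the section at
  \<open>u\<close> to \<open>F u\<close>. With \<open>F = k y\<close> it evaluates the combination
  at \<open>y\<close>.\<close>

definition lincomb :: "('b \<Rightarrow> real) \<Rightarrow> (real \<times> 'b) list \<Rightarrow> real" where
  "lincomb F l = (\<Sum>(c, u)\<leftarrow>l. c * F u)"

lemma lincomb_simps [simp]:
  "lincomb F [] = 0" "lincomb F ((c, u) # l) = c * F u + lincomb F l"
  "lincomb F (l @ m) = lincomb F l + lincomb F m"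
  by (simp_all add: lincomb_def)

lemma lincomb_scale: "lincomb F (scale t l) = t * lincomb F l"
  by (induction l) (auto simp: scale_def lincomb_def algebra_simps)

lemma lincomb_map: "lincomb F (map (map_prod id g) l) = lincomb (\<lambda>x. F (g x)) l"
  by (induction l) auto

text \<open>Bilinearity and change of variables for the form thereby reduce to facts about linear
  functionals.\<close>

lemma kform_eq_lincomb: "kform k l m = lincomb (\<lambda>u. lincomb (k u) m) l"
  by (induction l) (auto simp: kform_def lincomb_def sum_list_const_mult[symmetric] case_prod_unfold mult.assoc)

lemma kform_single: "kform k [(1, u)] m = lincomb (k u) m"
  by (simp add: kform_eq_lincomb)

lemma kform_append_left: "kform k (l @ l') m = kform k l m + kform k l' m"
  by (simp add: kform_eq_lincomb)

lemma kform_scale_left: "kform k (scale t l) m = t * kform k l m"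
  by (simp add: kform_eq_lincomb lincomb_scale)

lemma lincomb_fun_add: "lincomb (\<lambda>u. F u + G u) l = lincomb F l + lincomb G l"
  by (induction l) (auto simp: algebra_simps)

lemma lincomb_fun_mult: "lincomb (\<lambda>u. t * F u) l = t * lincomb F l"
  by (induction l) (auto simp: algebra_simps)

lemma kform_append_right: "kform k l (m @ m') = kform k l m + kform k l m'"
  by (simp add: kform_eq_lincomb lincomb_fun_add)

lemma kform_scale_right: "kform k l (scale t m) = t * kform k l m"
  by (simp add: kform_eq_lincomb lincomb_scale lincomb_fun_mult)

lemma lincomb_swap: "lincomb (\<lambda>u. lincomb (\<lambda>v. k u v) m) l = lincomb (\<lambda>v. lincomb (\<lambda>u. k u v) l) m"
  by (induction l) (auto simp: lincomb_fun_add lincomb_fun_mult, induction m, auto)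

lemma lincomb_cong: "(\<And>u. u \<in> snd ` set l \<Longrightarrow> F u = G u) \<Longrightarrow> lincomb F l = lincomb G l"
  by (induction l) auto

lemma kform_commute:
  assumes "psd_on W k" "snd ` set l \<subseteq> W" "snd ` set m \<subseteq> W"
  shows "kform k l m = kform k m l"
  unfolding kform_eq_lincomb
  by (subst lincomb_swap, intro lincomb_cong) (use assms in \<open>auto simp: psd_on_def subset_iff\<close>)

lemma kform_nonneg:
  assumes "psd_on W k" "snd ` set l \<subseteq> W"
  shows "0 \<le> kform k l l"
proof -
  have "kform k l l = (\<Sum>i<length l. \<Sum>j<length l.
          fst (l ! i) * fst (l ! j) * k (snd (l ! i)) (snd (l ! j)))"
    by (simp add: kform_def sum_list_sum_nth case_prod_unfold atLeast0LessThan)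
  moreover have "\<forall>i<length l. snd (l ! i) \<in> W"
    using assms(2) nth_mem by blast
  ultimately show ?thesis
    using assms(1) unfolding psd_on_def by simp
qed

text \<open>For \<open>a > 0\<close> evaluate at the minimiser \<open>- b / a\<close>; for
  \<open>a = 0\<close> an affine function bounded below has slope zero. Both Cauchy-Schwarz
  inequalities and the variational estimates below rest on this.\<close>

lemma quadratic_nonneg_discriminant:
  fixes a b c :: real
  assumes "\<And>t. 0 \<le> c + 2 * t * b + t\<^sup>2 * a" "0 \<le> a"
  shows "b\<^sup>2 \<le> c * a"
proof (cases "a = 0")
  case True
  have "b = 0"
  proof (rule ccontr)
    assume "b \<noteq> 0"
    \<comment> \<open>At this \<open>t\<close> the affine function takes the value
      \<open>c - \<bar>c\<bar> - 1\<close>, which is negative.\<close>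
    then have "2 * (- (\<bar>c\<bar> + 1) / (2 * b)) * b = - (\<bar>c\<bar> + 1)"
      by simp
    then show False
      using assms(1)[of "- (\<bar>c\<bar> + 1) / (2 * b)"] True by simp
  qed
  then show ?thesis using True by simp
next
  case False
  then show ?thesis
    using assms(1)[of "- b / a"] assms(2) by (auto simp: field_simps power2_eq_square)
qed

lemma kform_Cauchy_Schwarz:
  assumes "psd_on W k" "snd ` set l \<subseteq> W" "snd ` set m \<subseteq> W"
  shows "(kform k l m)\<^sup>2 \<le> kform k l l * kform k m m"
proof (rule quadratic_nonneg_discriminant)
  fix t
  have "0 \<le> kform k (l @ scale t m) (l @ scale t m)"
    by (rule kform_nonneg[OF assms(1)]) (use assms in \<open>auto simp: scale_def subset_iff\<close>)
  also have "\<dots> = kform k l l + 2 * t * kform k l m + t\<^sup>2 * kform k m m"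
    using kform_commute[OF assms(1,3,2)]
    by (simp add: kform_append_left kform_append_right kform_scale_left kform_scale_right
        power2_eq_square algebra_simps)
  finally show "0 \<le> kform k l l + 2 * t * kform k l m + t\<^sup>2 * kform k m m" .
qed (rule kform_nonneg[OF assms(1,3)])

text \<open>A near-minimiser of \<open>kform k l l - 2 * lincomb F l\<close>, the squared distance from the span of the
  kernel sections to \<open>F\<close> up to a constant, approximates \<open>F\<close> without any completeness.\<close>

lemma bounded_functional_approx:
  fixes W :: "'b set"
  assumes psd: "psd_on W k"
    and bound: "\<And>l. snd ` set l \<subseteq> W \<Longrightarrow> (lincomb F l)\<^sup>2 \<le> M\<^sup>2 * kform k l l"
    and "0 \<le> M" "0 < s"
  obtains l where "snd ` set l \<subseteq> W"
    "\<And>w. w \<in> W \<Longrightarrow> \<bar>lincomb (k w) l - F w\<bar> \<le> s * sqrt (k w w)"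
    "sqrt (kform k l l) \<le> M + s"
proof -
  define J where "J l = kform k l l - 2 * lincomb F l" for l
  define S :: "(real \<times> 'b) list set" where "S = {l. snd ` set l \<subseteq> W}"
  \<comment> \<open>The bound on \<open>F\<close> gives \<open>J l >= Q - 2 * M * sqrt Q\<close>
    with \<open>Q = kform k l l\<close>, and completing the square gives \<open>- M\<^sup>2\<close>.
    So the infimum of \<open>J\<close> is finite.\<close>
  have lower: "- M\<^sup>2 \<le> J l" if "l \<in> S" for l
  proof -
    have Q: "0 \<le> kform k l l" using kform_nonneg[OF psd] that by (simp add: S_def)
    have "\<bar>lincomb F l\<bar> \<le> sqrt (M\<^sup>2 * kform k l l)"
      using bound[of l] that by (intro real_le_rsqrt) (simp add: S_def)
    also have "\<dots> = M * sqrt (kform k l l)"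
      using \<open>0 \<le> M\<close> by (simp add: real_sqrt_mult)
    also have "2 * \<dots> \<le> M\<^sup>2 + kform k l l"
      using sum_squares_bound[of M "sqrt (kform k l l)"] Q by simp
    finally show ?thesis by (simp add: J_def)
  qed
  then have bdd: "bdd_below (J ` S)" by (intro bdd_belowI2)
  have "[] \<in> S" by (simp add: S_def)
  \<comment> \<open>The slack is \<open>s\<^sup>2\<close> because it becomes the constant
    coefficient of the quadratics below, whose discriminant bounds then make the residuals of order
    \<open>s\<close>.\<close>
  then have "\<exists>l\<in>S. J l < (INF l\<in>S. J l) + s\<^sup>2"
    using cInf_lessD[of "J ` S" "Inf (J ` S) + s\<^sup>2"] \<open>0 < s\<close> by auto
  then obtain l where l: "l \<in> S" "J l < (INF l\<in>S. J l) + s\<^sup>2" by blast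
  have near: "J l \<le> J m + s\<^sup>2" if "m \<in> S" for m
    using cINF_lower[OF bdd that] l(2) by linarith
  have lW: "snd ` set l \<subseteq> W" using l(1) by (simp add: S_def)
  have Q: "0 \<le> kform k l l" by (rule kform_nonneg[OF psd lW])
  have approx: "\<bar>lincomb (k w) l - F w\<bar> \<le> s * sqrt (k w w)" if w: "w \<in> W" for w
  proof -
    have kw: "kform k [(1, w)] [(1, w)] = k w w" by (simp add: kform_eq_lincomb)
    have nn: "0 \<le> k w w" using kform_nonneg[OF psd, of "[(1, w)]"] kw w by simp
    \<comment> \<open>Perturbing \<open>l\<close> along the section at \<open>w\<close> changes
      \<open>J\<close> to first order by twice the residual at \<open>w\<close>.\<close>
    have "(lincomb (k w) l - F w)\<^sup>2 \<le> s\<^sup>2 * k w w"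
    proof (rule quadratic_nonneg_discriminant[OF _ nn])
      fix t
      have "J l \<le> J (l @ scale t [(1, w)]) + s\<^sup>2"
        by (rule near) (use w lW in \<open>auto simp: S_def scale_def\<close>)
      also have "J (l @ scale t [(1, w)]) = J l + 2 * t * (lincomb (k w) l - F w) + t\<^sup>2 * k w w"
        using kform_commute[OF psd lW, of "[(1, w)]"] w
        by (simp add: J_def kform_append_left kform_append_right kform_scale_left kform_scale_right
            lincomb_scale kw kform_single algebra_simps power2_eq_square)
      finally show "0 \<le> s\<^sup>2 + 2 * t * (lincomb (k w) l - F w) + t\<^sup>2 * k w w" by simp
    qed
    then have "sqrt ((lincomb (k w) l - F w)\<^sup>2) \<le> sqrt (s\<^sup>2 * k w w)"
      by (rule real_sqrt_le_mono)
    then show ?thesis using \<open>0 < s\<close> by (simp add: real_sqrt_mult)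
  qed
  \<comment> \<open>Perturbing \<open>l\<close> along itself gives
    \<open>Q - lincomb F l <= s * sqrt Q\<close>. Together with
    \<open>lincomb F l <= M * sqrt Q\<close> this yields \<open>Q <= (M + s) * sqrt Q\<close>, hence
    the norm bound.\<close>
  have "(kform k l l - lincomb F l)\<^sup>2 \<le> s\<^sup>2 * kform k l l"
  proof (rule quadratic_nonneg_discriminant[OF _ Q])
    fix t
    have "J l \<le> J (l @ scale t l) + s\<^sup>2"
      by (rule near) (use lW in \<open>auto simp: S_def scale_def\<close>)
    also have "J (l @ scale t l)
        = J l + 2 * t * (kform k l l - lincomb F l) + t\<^sup>2 * kform k l l"
      by (simp add: J_def kform_append_left kform_append_right kform_scale_left kform_scale_right
          lincomb_scale algebra_simps power2_eq_square)
    finally show "0 \<le> s\<^sup>2 + 2 * t * (kform k l l - lincomb F l) + t\<^sup>2 * kform k l l" by simp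
  qed
  then have "sqrt ((kform k l l - lincomb F l)\<^sup>2) \<le> sqrt (s\<^sup>2 * kform k l l)"
    by (rule real_sqrt_le_mono)
  moreover have "sqrt ((lincomb F l)\<^sup>2) \<le> sqrt (M\<^sup>2 * kform k l l)"
    by (rule real_sqrt_le_mono[OF bound[OF lW]])
  ultimately have "kform k l l \<le> (M + s) * sqrt (kform k l l)"
    using \<open>0 < s\<close> \<open>0 \<le> M\<close> by (simp add: real_sqrt_mult algebra_simps)
  then have "sqrt (kform k l l) * sqrt (kform k l l) \<le> (M + s) * sqrt (kform k l l)"
    using Q by simp
  then have "sqrt (kform k l l) \<le> M + s"
    using \<open>0 < s\<close> \<open>0 \<le> M\<close> Q mult_right_le_imp_le[of "sqrt (kform k l l)" "sqrt (kform k l l)" "M + s"]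
    by (cases "kform k l l = 0") simp_all
  with lW approx show ?thesis by (rule that)
qed

section \<open>Finite combinations of kernel sections inside an RKHS\<close>

definition section_comb :: "'a set \<Rightarrow> ('a \<Rightarrow> 'a \<Rightarrow> real) \<Rightarrow> (real \<times> 'a) list \<Rightarrow> ('a \<Rightarrow> real)" where
  "section_comb E k l = (\<lambda>y\<in>E. lincomb (k y) l)"

lemma section_comb_mem:
  assumes "is_RKHS E k H ip" "snd ` set l \<subseteq> E"
  shows "section_comb E k l \<in> H"
  using assms(2)
proof (induction l)
  case Nil
  then show ?case
    using assms(1) unfolding section_comb_def is_RKHS_def function_hilbert_space_def lincomb_simps
    by blast
next
  case (Cons a l)
  obtain c x where a: "a = (c, x)" by fastforce
  have "(\<lambda>y\<in>E. k y x) \<in> H"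
    using assms(1) Cons.prems by (auto simp: a is_RKHS_def)
  then have "(\<lambda>y\<in>E. c * (\<lambda>y\<in>E. k y x) y) \<in> H"
    using assms(1) unfolding is_RKHS_def function_hilbert_space_def by blast
  moreover have "section_comb E k l \<in> H" using Cons by simp
  ultimately have "(\<lambda>z\<in>E. (\<lambda>y\<in>E. c * (\<lambda>y\<in>E. k y x) y) z + section_comb E k l z) \<in> H"
    using assms(1) unfolding is_RKHS_def function_hilbert_space_def by blast
  also have "(\<lambda>z\<in>E. (\<lambda>y\<in>E. c * (\<lambda>y\<in>E. k y x) y) z + section_comb E k l z)
      = section_comb E k (a # l)"
    by (auto simp: section_comb_def a restrict_def fun_eq_iff)
  finally show ?case .
qed

text \<open>The reproducing property is applied to each section and summed by linearity in the first
  argument.\<close>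

lemma inner_section_comb:
  assumes "is_RKHS E k H ip" "snd ` set l \<subseteq> E" "g \<in> H"
  shows "ip (section_comb E k l) g = lincomb g l"
  using assms(2)
proof (induction l)
  case Nil
  \<comment> \<open>The zero function is written as \<open>0 * g\<close>, so that homogeneity gives
    a zero inner product.\<close>
  have "ip (\<lambda>x\<in>E. 0 * g x) g = 0 * ip g g"
    using assms unfolding is_RKHS_def function_hilbert_space_def by blast
  then show ?case unfolding section_comb_def lincomb_simps mult_zero_left .
next
  case (Cons a l)
  obtain c x where a: "a = (c, x)" by fastforce
  have x: "x \<in> E" "snd ` set l \<subseteq> E" using Cons.prems by (auto simp: a)
  have kx: "(\<lambda>y\<in>E. k y x) \<in> H" "ip g (\<lambda>y\<in>E. k y x) = g x"
    using assms x by (auto simp: is_RKHS_def)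
  then have ckx: "(\<lambda>y\<in>E. c * (\<lambda>y\<in>E. k y x) y) \<in> H"
    using assms(1) unfolding is_RKHS_def function_hilbert_space_def by blast
  have "section_comb E k (a # l)
      = (\<lambda>z\<in>E. (\<lambda>y\<in>E. c * (\<lambda>y\<in>E. k y x) y) z + section_comb E k l z)"
    by (auto simp: section_comb_def a restrict_def fun_eq_iff)
  then have "ip (section_comb E k (a # l)) g
      = ip (\<lambda>z\<in>E. (\<lambda>y\<in>E. c * (\<lambda>y\<in>E. k y x) y) z + section_comb E k l z) g"
    by (rule arg_cong)
  also have "\<dots> = ip (\<lambda>y\<in>E. c * (\<lambda>y\<in>E. k y x) y) g + ip (section_comb E k l) g"
    using assms(1,3) ckx section_comb_mem[OF assms(1) x(2)]
    unfolding is_RKHS_def function_hilbert_space_def by blast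
  also have "ip (\<lambda>y\<in>E. c * (\<lambda>y\<in>E. k y x) y) g = c * ip (\<lambda>y\<in>E. k y x) g"
    using assms(1,3) kx unfolding is_RKHS_def function_hilbert_space_def by blast
  also have "ip (\<lambda>y\<in>E. k y x) g = ip g (\<lambda>y\<in>E. k y x)"
    using assms(1,3) kx unfolding is_RKHS_def function_hilbert_space_def by blast
  finally show ?case using Cons.IH x kx by (simp add: a)
qed

text \<open>Expand the squared norm of \<open>g + t * h\<close>. Linearity is axiomatised in the
  first argument only, so symmetry moves the combination there before each expansion.\<close>

lemma hilbert_Cauchy_Schwarz:
  assumes hs: "function_hilbert_space E H ip" and g: "g \<in> H" and h: "h \<in> H"
  shows "(ip g h)\<^sup>2 \<le> ip g g * ip h h"
proof (rule quadratic_nonneg_discriminant)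
  fix t
  define th where "th = (\<lambda>x\<in>E. t * h x)"
  define s where "s = (\<lambda>x\<in>E. g x + th x)"
  have add: "ip (\<lambda>x\<in>E. a x + b x) c = ip a c + ip b c"
    and mult: "ip (\<lambda>x\<in>E. r * a x) c = r * ip a c"
    and sym: "ip a b = ip b a"
    if "a \<in> H" "b \<in> H" "c \<in> H" for a b c r
    using hs that unfolding function_hilbert_space_def by blast+
  have th: "th \<in> H" using hs h unfolding th_def function_hilbert_space_def by blast
  then have s: "s \<in> H" using hs g unfolding s_def function_hilbert_space_def by blast
  have s1: "ip s a = ip g a + t * ip h a" if "a \<in> H" for a
    using add[OF g th that] mult[OF h h that] by (simp add: s_def th_def)
  have "ip s s = ip g g + 2 * t * ip g h + t\<^sup>2 * ip h h"
    using s1[OF s] s1[OF g] s1[OF h] sym[OF g s s] sym[OF h s s] sym[OF g h h]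
    by (simp add: algebra_simps power2_eq_square)
  then show "0 \<le> ip g g + 2 * t * ip g h + t\<^sup>2 * ip h h"
    using hs s unfolding function_hilbert_space_def by metis
qed (use hs h in \<open>auto simp: function_hilbert_space_def\<close>)

lemma hs_norm_nonneg:
  assumes "is_RKHS E k H ip" "h \<in> H" shows "0 \<le> hs_norm ip h" "(hs_norm ip h)\<^sup>2 = ip h h"
  using assms by (auto simp: hs_norm_def is_RKHS_def function_hilbert_space_def)

text \<open>Pairing \<open>h\<close> with the combination of sections gives
  \<open>lincomb h l\<close>, and the combination has squared norm \<open>kform k l l\<close>, so
  Cauchy-Schwarz applies. This supplies the boundedness hypothesis of
  \<open>bounded_functional_approx\<close>.\<close>

lemma lincomb_le_kform:
  assumes rk: "is_RKHS E k H ip" and l: "snd ` set l \<subseteq> E" and h: "h \<in> H"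
  shows "(lincomb h l)\<^sup>2 \<le> (hs_norm ip h)\<^sup>2 * kform k l l"
proof -
  have "ip (section_comb E k l) (section_comb E k l) = lincomb (section_comb E k l) l"
    by (rule inner_section_comb[OF rk l section_comb_mem[OF rk l]])
  also have "\<dots> = lincomb (\<lambda>y. lincomb (k y) l) l"
    by (intro lincomb_cong) (use l in \<open>auto simp: section_comb_def\<close>)
  finally have "ip (section_comb E k l) (section_comb E k l) = kform k l l"
    by (simp add: kform_eq_lincomb)
  moreover have "(ip (section_comb E k l) h)\<^sup>2
      \<le> ip (section_comb E k l) (section_comb E k l) * ip h h"
    using hilbert_Cauchy_Schwarz[OF _ section_comb_mem[OF rk l] h] rk unfolding is_RKHS_def by blast
  ultimately show ?thesis
    using inner_section_comb[OF rk l h] hs_norm_nonneg[OF rk h] by (simp add: mult.commute)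
qed

lemma RKHS_pointwise_bound:
  assumes rk: "is_RKHS E k H ip" and "x \<in> E" and h: "h \<in> H"
  shows "\<bar>h x\<bar> \<le> hs_norm ip h * sqrt (k x x)"
proof -
  have "(h x)\<^sup>2 \<le> (hs_norm ip h)\<^sup>2 * k x x"
    using lincomb_le_kform[OF rk _ h, of "[(1, x)]"] assms(2) by (simp add: kform_eq_lincomb)
  then have "sqrt ((h x)\<^sup>2) \<le> sqrt ((hs_norm ip h)\<^sup>2 * k x x)"
    by (rule real_sqrt_le_mono)
  then show ?thesis
    using hs_norm_nonneg(1)[OF rk h] by (simp add: real_sqrt_mult)
qed

section \<open>Transfer between the RKHSs of two feature maps\<close>

lemma kform_map:
  "kform k (map (map_prod id g) l) (map (map_prod id g) m) = kform (\<lambda>x y. k (g x) (g y)) l m"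
  by (simp add: kform_eq_lincomb lincomb_map)

lemma psd_on_compose:
  assumes "psd_on W k" "g ` X \<subseteq> W"
  shows "psd_on X (\<lambda>x y. k (g x) (g y))"
  unfolding psd_on_def
proof (intro conjI allI impI ballI)
  fix n :: nat and c x assume "\<forall>i<n. x i \<in> X"
  then have "\<forall>i<n. (g \<circ> x) i \<in> W" using assms(2) by auto
  then have "0 \<le> (\<Sum>i<n. \<Sum>j<n. c i * c j * k ((g \<circ> x) i) ((g \<circ> x) j))"
    using assms(1) unfolding psd_on_def by blast
  then show "0 \<le> (\<Sum>i<n. \<Sum>j<n. c i * c j * k (g (x i)) (g (x j)))" by simp
next
  fix u v assume "u \<in> X" "v \<in> X"
  then show "k (g u) (g v) = k (g v) (g u)" using assms unfolding psd_on_def by blast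
qed

lemma kform_cong:
  assumes "\<And>u v. u \<in> snd ` set l \<Longrightarrow> v \<in> snd ` set m \<Longrightarrow> k u v = k' u v"
  shows "kform k l m = kform k' l m"
  unfolding kform_eq_lincomb by (intro lincomb_cong assms) auto

text \<open>Here \<open>r\<close> bounds the distance between the kernel sections at
  \<open>\<phi> x\<close> and \<open>\<psi> x\<close>, \<open>\<kappa>\<close> bounds the norms of
  the sections, and \<open>\<eta>\<close> pays for two approximations by finite
  combinations.\<close>

lemma RKHS_transfer:
  assumes psd: "psd_on W kW" and \<phi>: "\<phi> ` X \<subseteq> W" and \<psi>: "\<psi> ` X \<subseteq> W"
    and k: "\<forall>x\<in>X. \<forall>y\<in>X. k x y = kW (\<phi> x) (\<phi> y)"
    and k': "\<forall>x\<in>X. \<forall>y\<in>X. k' x y = kW (\<psi> x) (\<psi> y)"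
    and rk: "is_RKHS X k H ip" and rk': "is_RKHS X k' H' ip'"
    and h: "h \<in> H" and "0 \<le> r" "0 \<le> \<kappa>" "0 < \<eta>"
    and diag: "\<And>w. w \<in> W \<Longrightarrow> kW w w \<le> \<kappa>\<^sup>2"
    and close: "\<And>x. x \<in> X \<Longrightarrow> kW (\<phi> x) (\<phi> x) - 2 * kW (\<phi> x) (\<psi> x) + kW (\<psi> x) (\<psi> x) \<le> r\<^sup>2"
  shows "\<exists>g\<in>H'. \<forall>x\<in>X. \<bar>h x - g x\<bar> \<le> r * hs_norm ip h + \<eta>"
proof -
  \<comment> \<open>The errors add up to \<open>s * \<kappa>\<close> for each of the two
    approximations and \<open>s * r\<close> for the excess norm of the first one. The summand 1
    keeps the denominator positive.\<close>
  define s where "s = \<eta> / (r + 2 * \<kappa> + 1)"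
  have s: "0 < s" "s * (r + 2 * \<kappa>) \<le> \<eta>"
    using \<open>0 \<le> r\<close> \<open>0 \<le> \<kappa>\<close> \<open>0 < \<eta>\<close> by (auto simp: s_def field_simps)
  have sq: "sqrt (kW w w) \<le> \<kappa>" if "w \<in> W" for w
    using diag[OF that] \<open>0 \<le> \<kappa>\<close> by (simp add: real_le_lsqrt)
  have bound: "(lincomb h l)\<^sup>2 \<le> (hs_norm ip h)\<^sup>2 * kform (\<lambda>x y. kW (\<phi> x) (\<phi> y)) l l"
    if "snd ` set l \<subseteq> X" for l
  proof -
    have "kform (\<lambda>x y. kW (\<phi> x) (\<phi> y)) l l = kform k l l"
      by (rule kform_cong) (use that k in \<open>auto simp: subset_iff\<close>)
    then show ?thesis using lincomb_le_kform[OF rk that h] by simp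
  qed
  obtain l where l: "snd ` set l \<subseteq> X"
    "\<And>x. x \<in> X \<Longrightarrow> \<bar>lincomb (\<lambda>y. kW (\<phi> x) (\<phi> y)) l - h x\<bar> \<le> s * sqrt (kW (\<phi> x) (\<phi> x))"
    "sqrt (kform (\<lambda>x y. kW (\<phi> x) (\<phi> y)) l l) \<le> hs_norm ip h + s"
  proof (rule bounded_functional_approx[where W = X and k = "\<lambda>x y. kW (\<phi> x) (\<phi> y)"
        and F = h and M = "hs_norm ip h" and s = s])
    show "psd_on X (\<lambda>x y. kW (\<phi> x) (\<phi> y))" by (rule psd_on_compose[OF psd \<phi>])
  qed (use bound hs_norm_nonneg(1)[OF rk h] s(1) in simp_all)
  define L where "L = map (map_prod id \<phi>) l"
  \<comment> \<open>\<open>G\<close> lives on all of \<open>W\<close>, so it can be evaluated on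
    both feature maps: along \<open>\<phi>\<close> it is close to \<open>h\<close>, along
    \<open>\<psi>\<close> it is the function to be approximated in \<open>H'\<close>.\<close>
  define G where "G w = lincomb (kW w) L" for w
  have LW: "snd ` set L \<subseteq> W" using l(1) \<phi> by (force simp: L_def)
  have QL: "sqrt (kform kW L L) \<le> hs_norm ip h + s" using l(3) by (simp add: L_def kform_map)
  have Q0: "0 \<le> kform kW L L" by (rule kform_nonneg[OF psd LW])
  have step1: "\<bar>G (\<phi> x) - h x\<bar> \<le> s * \<kappa>" if "x \<in> X" for x
  proof -
    have "\<bar>G (\<phi> x) - h x\<bar> \<le> s * sqrt (kW (\<phi> x) (\<phi> x))"
      using l(2)[OF that] by (simp add: G_def L_def lincomb_map)
    also have "\<dots> \<le> s * \<kappa>" using sq[of "\<phi> x"] \<phi> that s(1) by (intro mult_left_mono) auto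
    finally show ?thesis .
  qed
  have step2: "\<bar>G (\<phi> x) - G (\<psi> x)\<bar> \<le> (hs_norm ip h + s) * r" if x: "x \<in> X" for x
  proof -
    \<comment> \<open>The difference of the sections at \<open>\<phi> x\<close> and
      \<open>\<psi> x\<close>: its form is the squared feature distance, and its pairing with
      \<open>L\<close> is the change in \<open>G\<close>.\<close>
    define m :: "(real \<times> _) list" where "m = [(1, \<phi> x), (-1, \<psi> x)]"
    have m: "snd ` set m \<subseteq> W" using \<phi> \<psi> x by (auto simp: m_def)
    have "kform kW m m = kW (\<phi> x) (\<phi> x) - 2 * kW (\<phi> x) (\<psi> x) + kW (\<psi> x) (\<psi> x)"
    proof -
      have "kW (\<psi> x) (\<phi> x) = kW (\<phi> x) (\<psi> x)"
        using psd \<phi> \<psi> x unfolding psd_on_def by blast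
      then show ?thesis by (simp add: m_def kform_eq_lincomb)
    qed
    then have mm: "sqrt (kform kW m m) \<le> r"
      using close[OF x] \<open>0 \<le> r\<close> by (simp add: real_le_lsqrt)
    have "G (\<phi> x) - G (\<psi> x) = kform kW m L" by (simp add: m_def kform_eq_lincomb G_def)
    then have "(G (\<phi> x) - G (\<psi> x))\<^sup>2 \<le> kform kW m m * kform kW L L"
      using kform_Cauchy_Schwarz[OF psd m LW] by simp
    then have "sqrt ((G (\<phi> x) - G (\<psi> x))\<^sup>2) \<le> sqrt (kform kW m m * kform kW L L)"
      by (rule real_sqrt_le_mono)
    then have "\<bar>G (\<phi> x) - G (\<psi> x)\<bar> \<le> sqrt (kform kW L L) * sqrt (kform kW m m)"
      by (simp add: real_sqrt_mult mult.commute)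
    also have "\<dots> \<le> (hs_norm ip h + s) * r"
      using QL mm Q0 s(1) hs_norm_nonneg(1)[OF rk h] kform_nonneg[OF psd m]
      by (intro mult_mono) auto
    finally show ?thesis .
  qed
  \<comment> \<open>Pulled back along \<open>\<psi>\<close>, \<open>G\<close> is a functional
    bounded by the norm of \<open>L\<close>, so the approximation lemma applies a second
    time.\<close>
  have bound': "(lincomb (\<lambda>x. G (\<psi> x)) j)\<^sup>2
      \<le> (sqrt (kform kW L L))\<^sup>2 * kform (\<lambda>x y. kW (\<psi> x) (\<psi> y)) j j"
    if "snd ` set j \<subseteq> X" for j
  proof -
    define m where "m = map (map_prod id \<psi>) j"
    have m: "snd ` set m \<subseteq> W" using that \<psi> by (force simp: m_def)
    have "lincomb (\<lambda>x. G (\<psi> x)) j = kform kW m L"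
      by (simp add: m_def kform_eq_lincomb lincomb_map G_def)
    then show ?thesis
      using kform_Cauchy_Schwarz[OF psd m LW] Q0 by (simp add: m_def kform_map mult.commute)
  qed
  obtain j where j: "snd ` set j \<subseteq> X"
    "\<And>x. x \<in> X \<Longrightarrow> \<bar>lincomb (\<lambda>y. kW (\<psi> x) (\<psi> y)) j - G (\<psi> x)\<bar> \<le> s * sqrt (kW (\<psi> x) (\<psi> x))"
  proof (rule bounded_functional_approx[where W = X and k = "\<lambda>x y. kW (\<psi> x) (\<psi> y)"
        and F = "\<lambda>x. G (\<psi> x)" and M = "sqrt (kform kW L L)" and s = s])
    show "psd_on X (\<lambda>x y. kW (\<psi> x) (\<psi> y))" by (rule psd_on_compose[OF psd \<psi>])
  qed (use bound' Q0 s(1) in simp_all)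
  show ?thesis
  proof (intro bexI ballI)
    show "section_comb X k' j \<in> H'" by (rule section_comb_mem[OF rk' j(1)])
    fix x assume x: "x \<in> X"
    have "section_comb X k' j x = lincomb (\<lambda>y. kW (\<psi> x) (\<psi> y)) j"
      using x j(1) k' by (auto simp: section_comb_def subset_iff intro!: lincomb_cong)
    then have "\<bar>section_comb X k' j x - G (\<psi> x)\<bar> \<le> s * sqrt (kW (\<psi> x) (\<psi> x))"
      using j(2)[OF x] by simp
    also have "\<dots> \<le> s * \<kappa>" using sq[of "\<psi> x"] \<psi> x s(1) by (intro mult_left_mono) auto
    finally have "\<bar>h x - section_comb X k' j x\<bar> \<le> s * \<kappa> + (hs_norm ip h + s) * r + s * \<kappa>"
      using step1[OF x] step2[OF x] by linarith
    also have "\<dots> = r * hs_norm ip h + s * (r + 2 * \<kappa>)" by (simp add: algebra_simps)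
    finally show "\<bar>h x - section_comb X k' j x\<bar> \<le> r * hs_norm ip h + \<eta>" using s(2) by linarith
  qed
qed

section \<open>Inner products of square-summable sequences\<close>

lemma ell2_summable_mult:
  assumes "u \<in> ell2" "v \<in> ell2"
  shows "summable (\<lambda>n. u n * v n)"
proof (rule summable_comparison_test')
  show "summable (\<lambda>n. (u n)\<^sup>2 + (v n)\<^sup>2)"
    using assms by (intro summable_add) (auto simp: ell2_def)
  fix n show "norm (u n * v n) \<le> (u n)\<^sup>2 + (v n)\<^sup>2"
    using sum_squares_bound[of "\<bar>u n\<bar>" "\<bar>v n\<bar>"] abs_ge_zero[of "u n * v n"]
    unfolding real_norm_def abs_mult power2_abs by linarith
qed

lemma ell2_inner_commute: "ell2_inner u v = ell2_inner v u"
  by (simp add: ell2_inner_def mult.commute)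

lemma ell2_inner_self_nonneg: "u \<in> ell2 \<Longrightarrow> 0 \<le> ell2_inner u u"
  unfolding ell2_inner_def by (intro suminf_nonneg ell2_summable_mult) auto

lemma ell2_norm_diff:
  assumes "u \<in> ell2" "v \<in> ell2"
  shows "(ell2_norm (\<lambda>n. u n - v n))\<^sup>2 = ell2_inner u u - 2 * ell2_inner u v + ell2_inner v v"
    and "0 \<le> ell2_inner u u - 2 * ell2_inner u v + ell2_inner v v"
proof -
  note s = ell2_summable_mult
  have "(\<lambda>n. u n * u n - 2 * (u n * v n) + v n * v n) sums
      (ell2_inner u u - 2 * ell2_inner u v + ell2_inner v v)"
    unfolding ell2_inner_def
    by (intro sums_add sums_diff sums_mult summable_sums s assms)
  then have *: "(\<lambda>n. (u n - v n) * (u n - v n)) sums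
      (ell2_inner u u - 2 * ell2_inner u v + ell2_inner v v)"
    by (simp add: algebra_simps)
  show nn: "0 \<le> ell2_inner u u - 2 * ell2_inner u v + ell2_inner v v"
    by (rule sums_le[OF _ sums_zero *]) simp
  have "ell2_inner (\<lambda>n. u n - v n) (\<lambda>n. u n - v n)
      = ell2_inner u u - 2 * ell2_inner u v + ell2_inner v v"
    using sums_unique[OF *] by (simp add: ell2_inner_def)
  with nn show "(ell2_norm (\<lambda>n. u n - v n))\<^sup>2
      = ell2_inner u u - 2 * ell2_inner u v + ell2_inner v v"
    by (simp add: ell2_norm_def)
qed

lemma ell2_uminus: "u \<in> ell2 \<Longrightarrow> (\<lambda>n. - u n) \<in> ell2"
  by (simp add: ell2_def)

text \<open>The squared norms of \<open>u - v\<close> and \<open>u + v\<close> are nonnegative. The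
  arithmetic mean suffices in place of the geometric one because all of \<open>W\<close> shares one
  norm bound.\<close>

lemma abs_ell2_inner_le:
  assumes "u \<in> ell2" "v \<in> ell2"
  shows "\<bar>ell2_inner u v\<bar> \<le> (ell2_inner u u + ell2_inner v v) / 2"
proof -
  have "ell2_inner u (\<lambda>n. - v n) = - ell2_inner u v"
    using suminf_minus[OF ell2_summable_mult[OF assms]] by (simp add: ell2_inner_def)
  moreover have "ell2_inner (\<lambda>n. - v n) (\<lambda>n. - v n) = ell2_inner v v"
    by (simp add: ell2_inner_def)
  ultimately show ?thesis
    using ell2_norm_diff(2)[OF assms] ell2_norm_diff(2)[OF assms(1) ell2_uminus[OF assms(2)]]
    by (simp add: field_simps abs_le_iff)
qed

section \<open>Constructions of positive semi-definite kernels\<close>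

lemma psd_on_cong:
  assumes "psd_on W k" "\<And>u v. u \<in> W \<Longrightarrow> v \<in> W \<Longrightarrow> k u v = k' u v"
  shows "psd_on W k'"
  unfolding psd_on_def
proof (intro conjI allI impI ballI)
  fix n :: nat and c x assume x: "\<forall>i<n. x i \<in> W"
  then have "0 \<le> (\<Sum>i<n. \<Sum>j<n. c i * c j * k (x i) (x j))"
    by (intro psd_onD[OF assms(1)]) simp
  also have "\<dots> = (\<Sum>i<n. \<Sum>j<n. c i * c j * k' (x i) (x j))"
    using x assms(2) by (intro sum.cong) auto
  finally show "0 \<le> (\<Sum>i<n. \<Sum>j<n. c i * c j * k' (x i) (x j))" .
next
  fix u v assume "u \<in> W" "v \<in> W"
  then show "k' u v = k' v u" using assms(1) assms(2)[of u v] assms(2)[of v u] by (simp add: psd_on_def)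
qed

lemma psd_on_subset: "psd_on W k \<Longrightarrow> V \<subseteq> W \<Longrightarrow> psd_on V k"
  unfolding psd_on_def by blast

text \<open>Each quadratic form is a finite sum of kernel values, so pointwise convergence of the
  series carries over to it and preserves the sign.\<close>

lemma psd_on_sums:
  assumes "\<And>m::nat. psd_on W (k m)"
    and lim: "\<And>u v. u \<in> W \<Longrightarrow> v \<in> W \<Longrightarrow> (\<lambda>m. k m u v) sums K u v"
  shows "psd_on W K"
  unfolding psd_on_def
proof (intro conjI allI impI ballI)
  fix n :: nat and c x assume x: "\<forall>i<n. x i \<in> W"
  have *: "(\<lambda>m. \<Sum>i<n. \<Sum>j<n. c i * c j * k m (x i) (x j)) sums
      (\<Sum>i<n. \<Sum>j<n. c i * c j * K (x i) (x j))"
    using x by (intro sums_sum sums_mult lim) auto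
  show "0 \<le> (\<Sum>i<n. \<Sum>j<n. c i * c j * K (x i) (x j))"
  proof (rule sums_le[OF _ sums_zero *])
    show "0 \<le> (\<Sum>i<n. \<Sum>j<n. c i * c j * k m (x i) (x j))" for m
      using x by (intro psd_onD[OF assms(1)]) simp
  qed
next
  fix u v assume "u \<in> W" "v \<in> W"
  then have "(\<lambda>m. k m u v) sums K u v" "(\<lambda>m. k m u v) sums K v u"
    using lim[of u v] lim[of v u] assms(1) by (simp_all add: psd_on_def)
  then show "K u v = K v u" by (rule sums_unique2)
qed

text \<open>The factor \<open>g\<close> is absorbed into the coefficients.\<close>

lemma psd_on_rescale:
  assumes "psd_on W k"
  shows "psd_on W (\<lambda>u v. g u * g v * k u v)"
  unfolding psd_on_def
proof (intro conjI allI impI ballI)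
  fix n :: nat and c x assume "\<forall>i<n. x i \<in> W"
  then have "0 \<le> (\<Sum>i<n. \<Sum>j<n. (c i * g (x i)) * (c j * g (x j)) * k (x i) (x j))"
    using psd_onD[OF assms, of n x "\<lambda>i. c i * g (x i)"] by blast
  then show "0 \<le> (\<Sum>i<n. \<Sum>j<n. c i * c j * (g (x i) * g (x j) * k (x i) (x j)))"
    by (simp add: mult_ac)
qed (use assms in \<open>auto simp: psd_on_def\<close>)

lemma psd_on_cmult:
  assumes "psd_on W k" "0 \<le> a"
  shows "psd_on W (\<lambda>u v. a * k u v)"
  using psd_on_rescale[OF assms(1), of "\<lambda>_. sqrt a"] assms(2) by simp

lemma psd_on_one: "psd_on W (\<lambda>_ _. 1)"
proof -
  have "(\<Sum>i<n. \<Sum>j<n. c i * c j) = (\<Sum>i<n. c i)\<^sup>2" for n :: nat and c :: "nat \<Rightarrow> real"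
    by (simp add: power2_eq_square sum_product)
  then show ?thesis by (simp add: psd_on_def)
qed

text \<open>The Schur product with the inner product is a sum of rescalings by the coordinates.\<close>

lemma psd_on_inner_mult:
  assumes "psd_on ell2 k"
  shows "psd_on ell2 (\<lambda>u v. ell2_inner u v * k u v)"
proof (rule psd_on_sums)
  show "psd_on ell2 (\<lambda>u v. u m * v m * k u v)" for m
    by (rule psd_on_rescale[OF assms, of "\<lambda>u. u m"])
  show "(\<lambda>m. u m * v m * k u v) sums (ell2_inner u v * k u v)" if "u \<in> ell2" "v \<in> ell2" for u v
    unfolding ell2_inner_def by (intro sums_mult2 summable_sums ell2_summable_mult that)
qed

lemma psd_on_inner_power: "psd_on ell2 (\<lambda>u v. ell2_inner u v ^ n)"
  by (induction n) (simp_all add: psd_on_one psd_on_inner_mult)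

text \<open>Expanding the squared distance factors the kernel as
  \<open>exp (2 * s * ell2_inner u v)\<close>, a power series with nonnegative coefficients, times
  one factor in \<open>u\<close> and the same factor in \<open>v\<close>.\<close>

lemma psd_on_gaussian:
  assumes "0 \<le> s"
  shows "psd_on ell2 (\<lambda>u v. exp (- s * (ell2_norm (\<lambda>n. u n - v n))\<^sup>2))"
proof (rule psd_on_cong)
  have "psd_on ell2 (\<lambda>u v. exp (2 * s * ell2_inner u v))"
  proof (rule psd_on_sums)
    show "psd_on ell2 (\<lambda>u v. ((2 * s) ^ n / fact n) * ell2_inner u v ^ n)" for n
      by (intro psd_on_cmult psd_on_inner_power) (use assms in simp)
    show "(\<lambda>n. ((2 * s) ^ n / fact n) * ell2_inner u v ^ n) sums exp (2 * s * ell2_inner u v)"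
      for u v
      using exp_converges[of "2 * s * ell2_inner u v"]
      by (simp add: power_mult_distrib divide_inverse mult_ac)
  qed
  then show "psd_on ell2 (\<lambda>u v. exp (- s * ell2_inner u u) * exp (- s * ell2_inner v v)
      * exp (2 * s * ell2_inner u v))"
    by (rule psd_on_rescale)
  show "exp (- s * ell2_inner u u) * exp (- s * ell2_inner v v) * exp (2 * s * ell2_inner u v)
      = exp (- s * (ell2_norm (\<lambda>n. u n - v n))\<^sup>2)" if "u \<in> ell2" "v \<in> ell2" for u v
    by (simp add: ell2_norm_diff[OF that] exp_add[symmetric] algebra_simps)
qed

section \<open>Mean value bound and truncation of the feature map\<close>

lemma C1_on_Lipschitz:
  fixes K :: "real \<Rightarrow> real"
  assumes "C1_on {a..b} K" "x \<in> {a..b}" "y \<in> {a..b}"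
  shows "\<bar>K x - K y\<bar> \<le> max_abs_deriv {a..b} K * \<bar>x - y\<bar>"
proof -
  let ?K' = "\<lambda>t. vector_derivative K (at t within {a..b})"
  have "continuous_on {a..b} (\<lambda>t. \<bar>?K' t\<bar>)"
    using assms(1) unfolding C1_on_def by (intro continuous_on_rabs) auto
  \<comment> \<open>Continuity on a compact interval bounds the derivative, so the supremum in
    \<open>max_abs_deriv\<close> really dominates its values.\<close>
  then have bdd: "bdd_above ((\<lambda>t. \<bar>?K' t\<bar>) ` {a..b})"
    by (intro bounded_imp_bdd_above compact_imp_bounded compact_continuous_image) auto
  have "norm (K x - K y) \<le> max_abs_deriv {a..b} K * norm (x - y)"
  proof (rule field_differentiable_bound[of "{a..b}" K ?K'])
    fix z assume z: "z \<in> {a..b}"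
    then have "K differentiable (at z within {a..b})"
      using assms(1) by (simp add: C1_on_def differentiable_on_def)
    then show "(K has_field_derivative ?K' z) (at z within {a..b})"
      by (simp add: has_real_derivative_iff_has_vector_derivative vector_derivative_works)
    show "norm (?K' z) \<le> max_abs_deriv {a..b} K"
      using cSUP_upper[OF z bdd] by (simp add: max_abs_deriv_def)
  qed (use assms in auto)
  then show ?thesis by simp
qed

text \<open>\<open>v\<close> is the orthogonal projection of \<open>u\<close> onto the first
  \<open>N\<close> coordinates; the second part is Pythagoras.\<close>

lemma ell2_truncate:
  assumes u: "u \<in> ell2" and v: "v = (\<lambda>n. if n < N then u n else 0)"
  shows "ell2_inner u v = ell2_inner v v"
    and "ell2_inner u u = ell2_inner v v + (\<Sum>n. (u (n + N))\<^sup>2)"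
proof -
  show "ell2_inner u v = ell2_inner v v"
    unfolding ell2_inner_def v by (intro suminf_cong) simp
  have "ell2_inner v v = (\<Sum>n<N. u n * u n)"
    unfolding ell2_inner_def by (subst suminf_finite[of "{..<N}"]) (auto simp: v)
  then show "ell2_inner u u = ell2_inner v v + (\<Sum>n. (u (n + N))\<^sup>2)"
    using suminf_split_initial_segment[OF ell2_summable_mult[OF u u], of N]
    by (simp add: ell2_inner_def power2_eq_square)
qed

text \<open>This is the reciprocal of the sum of the geometric series with ratio
  \<open>1 / q\<^sup>2\<close>, so the constant cancels in the tail estimate.\<close>

lemma c_phi_power2: "q > 1 \<Longrightarrow> (c_phi q)\<^sup>2 = 1 - 1 / q\<^sup>2"
  by (simp add: c_phi_def power_divide diff_divide_distrib)

text \<open>Distances are at most the diameter, which leaves a geometric tail. The normalisation by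
  \<open>c_phi\<close> removes its constant factor.\<close>

lemma phi_tail_le:
  fixes X :: "'a::metric_space set"
  assumes "bounded X" "range xs \<subseteq> X" "q > 1" "x \<in> X"
  shows "(\<Sum>n. (phi q xs x (n + N))\<^sup>2) \<le> (diameter X / q ^ N)\<^sup>2"
proof -
  let ?D = "diameter X"
  have "1 < q\<^sup>2" using \<open>q > 1\<close> by (intro one_less_power) auto
  then have "q\<^sup>2 \<noteq> 1" by (metis less_irrefl)
  have q2: "1 / q\<^sup>2 < 1" using \<open>q > 1\<close> by simp
  have le: "(phi q xs x n)\<^sup>2 \<le> (c_phi q)\<^sup>2 * ?D\<^sup>2 * (1 / q\<^sup>2) ^ n" for n
  proof -
    have "dist x (xs n) \<le> ?D"
      using assms by (intro diameter_bounded_bound) auto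
    then have "(c_phi q)\<^sup>2 * (dist x (xs n))\<^sup>2 / (q ^ n)\<^sup>2 \<le> (c_phi q)\<^sup>2 * ?D\<^sup>2 / (q ^ n)\<^sup>2"
      by (intro divide_right_mono mult_left_mono power_mono) auto
    then show ?thesis
      by (simp add: phi_def power_mult_distrib power_divide power_mult[symmetric] mult.commute)
  qed
  have g: "(\<lambda>n. (c_phi q)\<^sup>2 * ?D\<^sup>2 * (1 / q\<^sup>2) ^ N * (1 / q\<^sup>2) ^ n) sums
      ((c_phi q)\<^sup>2 * ?D\<^sup>2 * (1 / q\<^sup>2) ^ N * (1 / (1 - 1 / q\<^sup>2)))"
    by (intro sums_mult geometric_sums) (use q2 in simp)
  have "phi q xs x \<in> ell2"
    using W_set_subset_ell2[OF assms(1-3), of N] assms(4) by (auto simp: W_set_def)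
  then have "summable (\<lambda>n. (phi q xs x (n + N))\<^sup>2)"
    unfolding ell2_def using summable_ignore_initial_segment[of "\<lambda>n. (phi q xs x n)\<^sup>2" N] by simp
  then have "(\<Sum>n. (phi q xs x (n + N))\<^sup>2)
      \<le> (\<Sum>n. (c_phi q)\<^sup>2 * ?D\<^sup>2 * (1 / q\<^sup>2) ^ N * (1 / q\<^sup>2) ^ n)"
    using le[of "n + N" for n] sums_summable[OF g]
    by (intro suminf_le) (auto simp: power_add mult_ac)
  also have "\<dots> = (c_phi q)\<^sup>2 * ?D\<^sup>2 * (1 / q\<^sup>2) ^ N * (1 / (1 - 1 / q\<^sup>2))"
    by (rule sums_unique[OF g, symmetric])
  also have "\<dots> = (?D / q ^ N)\<^sup>2"
    using \<open>q\<^sup>2 \<noteq> 1\<close> \<open>q > 1\<close> by (simp add: c_phi_power2 power_divide power_mult[symmetric] mult.commute)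
  finally show ?thesis .
qed

lemma phi_truncation:
  fixes X :: "'a::metric_space set" and N :: nat
  assumes "bounded X" "range xs \<subseteq> X" "q > 1" "x \<in> X"
  defines "u \<equiv> phi q xs x" and "v \<equiv> pad N (phi_trunc q xs N x)"
  shows "ell2_inner u v = ell2_inner v v"
    and "ell2_inner v v \<le> ell2_inner u u"
    and "ell2_inner u u - ell2_inner v v \<le> (diameter X / q ^ N)\<^sup>2"
    and "ell2_inner u u \<le> (diameter X)\<^sup>2"
proof -
  have u: "u \<in> ell2"
    using W_set_subset_ell2[OF assms(1-3), of N] assms(4) by (auto simp: W_set_def u_def)
  \<comment> \<open>\<open>pad\<close> overwrites by 0 the default value that the restricted
    \<open>phi_trunc\<close> takes from index \<open>N\<close> on.\<close>
  have v: "v = (\<lambda>n. if n < N then u n else 0)"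
    by (auto simp: v_def u_def pad_def phi_trunc_def phi_def)
  have "summable (\<lambda>n. (u (n + N))\<^sup>2)"
    using u unfolding ell2_def using summable_ignore_initial_segment[of "\<lambda>n. (u n)\<^sup>2" N] by simp
  then have "0 \<le> (\<Sum>n. (u (n + N))\<^sup>2)" by (intro suminf_nonneg) auto
  then show "ell2_inner v v \<le> ell2_inner u u" using ell2_truncate(2)[OF u v] by simp
  show "ell2_inner u v = ell2_inner v v" by (rule ell2_truncate(1)[OF u v])
  show "ell2_inner u u - ell2_inner v v \<le> (diameter X / q ^ N)\<^sup>2"
    using ell2_truncate(2)[OF u v] phi_tail_le[OF assms(1-4), of N] by (simp add: u_def)
  \<comment> \<open>The tail that starts at index 0 is the whole squared norm.\<close>
  show "ell2_inner u u \<le> (diameter X)\<^sup>2"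
    using phi_tail_le[OF assms(1-4), of 0] by (simp add: u_def ell2_inner_def power2_eq_square)
qed

lemma W_set_inner_le:
  fixes X :: "'a::metric_space set"
  assumes "bounded X" "range xs \<subseteq> X" "q > 1" "w \<in> W_set X q xs N"
  shows "ell2_inner w w \<le> (diameter X)\<^sup>2"
  using assms(4) phi_truncation(2,4)[OF assms(1-3)] order_trans unfolding W_set_def by blast

section \<open>Taylor and radial kernels: positivity and strict estimates\<close>

text \<open>The kernel is a series of powers of the inner product with positive coefficients. The
  norm bound on \<open>W\<close> keeps the argument in the interval where the series represents
  \<open>K\<close>.\<close>

lemma taylor_psd:
  assumes "taylor_kernel D W K kW" "W \<subseteq> ell2" "\<And>w. w \<in> W \<Longrightarrow> ell2_inner w w \<le> D\<^sup>2"
  shows "psd_on W kW"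
proof -
  obtain a :: "nat \<Rightarrow> real" where "\<forall>n. a n > 0"
    "\<forall>t\<in>taylor_interval D. summable (\<lambda>n. \<bar>a n * t ^ n\<bar>) \<and> K t = (\<Sum>n. a n * t ^ n)"
    using assms(1) unfolding taylor_kernel_def by (elim conjE exE) (rule that)
  note a = this[rule_format]
  show ?thesis
  proof (rule psd_on_sums)
    show "psd_on W (\<lambda>u v. a n * ell2_inner u v ^ n)" for n
      by (rule psd_on_subset[OF psd_on_cmult[OF psd_on_inner_power less_imp_le[OF a(1)]] assms(2)])
    fix u v assume uv: "u \<in> W" "v \<in> W"
    then have "\<bar>ell2_inner u v\<bar> \<le> (ell2_inner u u + ell2_inner v v) / 2"
      using assms(2) by (intro abs_ell2_inner_le) auto
    also have "\<dots> \<le> D\<^sup>2" using assms(3)[OF uv(1)] assms(3)[OF uv(2)] by simp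
    finally have *: "ell2_inner u v \<in> taylor_interval D"
      using zero_le_power2[of D] by (simp add: abs_le_iff)
    then have "summable (\<lambda>n. a n * ell2_inner u v ^ n)"
      "K (ell2_inner u v) = (\<Sum>n. a n * ell2_inner u v ^ n)"
      using a(2)[OF *] summable_rabs_cancel[of "\<lambda>n. a n * ell2_inner u v ^ n"] by simp_all
    moreover have "kW u v = K (ell2_inner u v)"
      using assms(1) uv by (simp add: taylor_kernel_def)
    ultimately show "(\<lambda>n. a n * ell2_inner u v ^ n) sums kW u v"
      by (simp add: summable_sums)
  qed
qed

text \<open>\<open>K (D\<^sup>2) - K 0\<close> is at least the linear term
  \<open>a 1 * D\<^sup>2 > 0\<close>, while the mean value bound controls it from above. Positivity
  makes the estimate in \<open>taylor_case\<close> strict.\<close>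

lemma taylor_deriv_pos:
  assumes "taylor_kernel D W K kW" "D > 0"
  shows "0 < max_abs_deriv (taylor_interval D) K"
proof -
  obtain a :: "nat \<Rightarrow> real" where "\<forall>n. a n > 0"
    "\<forall>t\<in>taylor_interval D. summable (\<lambda>n. \<bar>a n * t ^ n\<bar>) \<and> K t = (\<Sum>n. a n * t ^ n)"
    using assms(1) unfolding taylor_kernel_def by (elim conjE exE) (rule that)
  note a = this[rule_format]
  have D: "D\<^sup>2 \<in> taylor_interval D" "0 \<in> taylor_interval D" "0 < D\<^sup>2"
    using \<open>D > 0\<close> by auto
  have "(\<Sum>n<2. a n * (D\<^sup>2) ^ n) \<le> K (D\<^sup>2)"
    using a(2)[OF D(1)] summable_rabs_cancel[of "\<lambda>n. a n * (D\<^sup>2) ^ n"] less_imp_le[OF a(1)]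
    by (simp add: sum_le_suminf)
  moreover have "K 0 = a 0" using a(2)[OF D(2)] by simp
  ultimately have "0 < K (D\<^sup>2) - K 0"
    using mult_pos_pos[OF a(1)[of 1] D(3)] by (simp add: numeral_2_eq_2)
  also have "\<dots> \<le> max_abs_deriv (taylor_interval D) K * D\<^sup>2"
    using C1_on_Lipschitz[of "- 4 * D\<^sup>2" "4 * D\<^sup>2" K "D\<^sup>2" 0] assms(1) D
    by (auto simp: taylor_kernel_def)
  finally show ?thesis using D(3) by (simp add: zero_less_mult_iff)
qed

lemma exp_integrable:
  fixes \<mu> :: "real measure"
  assumes "finite_measure \<mu>" "sets \<mu> = sets (restrict_space borel {0..})" "0 \<le> t"
  shows "integrable \<mu> (\<lambda>s. exp (- s * t))"
proof (rule finite_measure.integrable_const_bound[OF assms(1), of _ 1])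
  have "space \<mu> = {0..}"
    using sets_eq_imp_space_eq[OF assms(2)] by (simp add: space_restrict_space)
  then show "AE s in \<mu>. norm (exp (- s * t)) \<le> 1"
    using assms(3) by (intro AE_I2) simp
  have "(\<lambda>s::real. exp (- s * t)) \<in> borel_measurable (restrict_space borel {0..})"
    by (intro measurable_restrict_space1) measurable
  then show "(\<lambda>s. exp (- s * t)) \<in> borel_measurable \<mu>"
    using measurable_cong_sets[OF assms(2) refl] by blast
qed

text \<open>The kernel is a mixture of Gaussian kernels over \<open>s >= 0\<close>; its finite
  quadratic forms are integrals of nonnegative ones.\<close>

lemma radial_psd:
  assumes "radial_kernel D W K kW" "W \<subseteq> ell2"
  shows "psd_on W kW"
proof -
  obtain \<mu> :: "real measure" where fin: "finite_measure \<mu>"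
    and sets: "sets \<mu> = sets (restrict_space borel {0..})"
    and K_eq: "\<forall>t\<ge>0. K t = (\<integral>s. exp (- s * t) \<partial>\<mu>)"
    using assms(1) unfolding radial_kernel_def by (elim conjE exE) (rule that)
  note K = K_eq[rule_format]
  have sp: "space \<mu> = {0..}"
    using sets_eq_imp_space_eq[OF sets] by (simp add: space_restrict_space)
  define \<delta> where "\<delta> u v = (ell2_norm (\<lambda>n. u n - v n))\<^sup>2" for u v
  have kW: "kW u v = (\<integral>s. exp (- s * \<delta> u v) \<partial>\<mu>)" if "u \<in> W" "v \<in> W" for u v
    using assms(1) that K by (simp add: radial_kernel_def \<delta>_def)
  have int: "integrable \<mu> (\<lambda>s. exp (- s * \<delta> u v))" for u v
    by (rule exp_integrable[OF fin sets]) (simp add: \<delta>_def)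
  have psd: "psd_on W (\<lambda>u v. exp (- s * \<delta> u v))" if "0 \<le> s" for s
    using psd_on_subset[OF psd_on_gaussian[OF that] assms(2)] by (simp only: \<delta>_def)
  show ?thesis
    unfolding psd_on_def
  proof (intro conjI allI impI ballI)
    fix n :: nat and c x assume x: "\<forall>i<n. x i \<in> W"
    have "0 \<le> (\<integral>s. (\<Sum>i<n. \<Sum>j<n. c i * c j * exp (- s * \<delta> (x i) (x j))) \<partial>\<mu>)"
    proof (rule Bochner_Integration.integral_nonneg)
      fix s assume "s \<in> space \<mu>"
      then show "0 \<le> (\<Sum>i<n. \<Sum>j<n. c i * c j * exp (- s * \<delta> (x i) (x j)))"
        using x by (intro psd_onD[OF psd]) (simp_all add: sp)
    qed
    also have "\<dots> = (\<Sum>i<n. \<Sum>j<n. c i * c j * (\<integral>s. exp (- s * \<delta> (x i) (x j)) \<partial>\<mu>))"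
      using int by (simp add: Bochner_Integration.integral_sum)
    also have "\<dots> = (\<Sum>i<n. \<Sum>j<n. c i * c j * kW (x i) (x j))"
      using x by (intro sum.cong) (auto simp: kW)
    finally show "0 \<le> (\<Sum>i<n. \<Sum>j<n. c i * c j * kW (x i) (x j))" .
  next
    fix u v assume uv: "u \<in> W" "v \<in> W"
    then have "\<delta> u v = \<delta> v u"
      using assms(2) by (auto simp: \<delta>_def ell2_norm_diff ell2_inner_commute[of v u] subset_iff)
    then show "kW u v = kW v u" using uv by (simp add: kW)
  qed
qed

text \<open>The integrand decreases in its argument. This lets a squared distance that depends on
  the point be replaced by a uniform bound.\<close>

lemma radial_antimono:
  assumes "radial_kernel D W K kW" "0 \<le> s" "s \<le> t"
  shows "K t \<le> K s"
proof -
  obtain \<mu> :: "real measure" where fin: "finite_measure \<mu>"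
    and sets: "sets \<mu> = sets (restrict_space borel {0..})"
    and K_eq: "\<forall>t\<ge>0. K t = (\<integral>s. exp (- s * t) \<partial>\<mu>)"
    using assms(1) unfolding radial_kernel_def by (elim conjE exE) (rule that)
  note K = K_eq[rule_format]
  have sp: "space \<mu> = {0..}"
    using sets_eq_imp_space_eq[OF sets] by (simp add: space_restrict_space)
  have "(\<integral>r. exp (- r * t) \<partial>\<mu>) \<le> (\<integral>r. exp (- r * s) \<partial>\<mu>)"
    using assms(2,3) by (intro integral_mono exp_integrable[OF fin sets])
      (auto simp: sp mult_left_mono)
  then show ?thesis using assms(2,3) by (simp add: K)
qed

text \<open>Strictness is where the support condition enters: \<open>K\<close> is strictly convex, and the mean value
  bound on \<open>[0, t / 2]\<close> already accounts for more than half of the decrease on \<open>[0, t]\<close>.\<close>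

lemma radial_strict_decrease:
  assumes rad: "radial_kernel D W K kW" and t: "0 < t" "t \<le> 4 * D\<^sup>2"
  shows "K 0 - K t < max_abs_deriv (radial_interval D) K * t"
proof -
  obtain \<mu> :: "real measure" where fin: "finite_measure \<mu>"
    and sets: "sets \<mu> = sets (restrict_space borel {0..})"
    and supp: "\<not> measure_support \<mu> \<subseteq> {0}"
    and K_eq: "\<forall>t\<ge>0. K t = (\<integral>s. exp (- s * t) \<partial>\<mu>)"
    using rad unfolding radial_kernel_def by (elim conjE exE) (rule that)
  note K = K_eq[rule_format]
  have sp: "space \<mu> = {0..}"
    using sets_eq_imp_space_eq[OF sets] by (simp add: space_restrict_space)
  \<comment> \<open>The integrand of the second difference \<open>K 0 - 2 * K (t / 2) + K t\<close>
    is a perfect square.\<close>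
  define g where "g s = (1 - exp (- s * (t / 2)))\<^sup>2" for s :: real
  have g: "g = (\<lambda>s. exp (- s * 0) - 2 * exp (- s * (t / 2)) + exp (- s * t))"
    by (auto simp: g_def power2_eq_square algebra_simps exp_add[symmetric])
  note int = exp_integrable[OF fin sets]
  have gi: "integrable \<mu> g" unfolding g
    by (intro Bochner_Integration.integrable_add Bochner_Integration.integrable_diff
        integrable_mult_right int) (use t in auto)
  have e: "(\<integral>s. g s \<partial>\<mu>) = K 0 - 2 * K (t / 2) + K t"
    unfolding g using t int[of 0] int[of "t / 2"] int[of t] by (simp add: K)
  \<comment> \<open>\<open>g\<close> vanishes only at 0, so a zero integral would make the open
    half-line of positive numbers a null set, although it is a neighbourhood of a nonzero support
    point.\<close>
  have nz: "(\<integral>s. g s \<partial>\<mu>) \<noteq> 0"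
  proof
    assume "(\<integral>s. g s \<partial>\<mu>) = 0"
    then have "AE s in \<mu>. g s = 0"
      using integral_nonneg_eq_0_iff_AE[OF gi] unfolding g_def by simp
    then have "AE s in \<mu>. \<not> 0 < s"
      by (rule AE_mp) (use t in \<open>auto intro!: AE_I2 simp: g_def\<close>)
    moreover have "{0<..} \<inter> space \<mu> \<in> sets \<mu>"
      unfolding sp sets by (auto simp: sets_restrict_space)
    ultimately have "emeasure \<mu> ({0<..} \<inter> space \<mu>) = 0"
      by (subst (asm) AE_iff_measurable[of "{0<..} \<inter> space \<mu>"]) auto
    moreover obtain s where "s \<in> measure_support \<mu>" "s \<noteq> 0" using supp by blast
    ultimately show False
      using sp by (auto simp: measure_support_def dest!: spec[of _ "{0<..}"])
  qed
  have "0 \<le> (\<integral>s. g s \<partial>\<mu>)" by (simp add: g_def)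
  with nz have "0 < K 0 - 2 * K (t / 2) + K t" unfolding e by linarith
  then have "K 0 - K t < 2 * (K 0 - K (t / 2))" by (simp add: algebra_simps)
  also have "K 0 - K (t / 2) \<le> max_abs_deriv (radial_interval D) K * (t / 2)"
  proof -
    have "C1_on (radial_interval D) K" using rad unfolding radial_kernel_def by blast
    then have "\<bar>K 0 - K (t / 2)\<bar> \<le> max_abs_deriv (radial_interval D) K * \<bar>0 - t / 2\<bar>"
      by (rule C1_on_Lipschitz) (use t in auto)
    also have "\<bar>0 - t / 2\<bar> = t / 2" using t(1) by simp
    finally show ?thesis by (rule order_trans[OF abs_ge_self])
  qed
  finally show ?thesis by simp
qed

section \<open>Feature distance of the truncation for both kernels\<close>

text \<open>Since \<open>ell2_inner u v = ell2_inner v v\<close> for a feature \<open>u\<close> and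
  its truncation \<open>v\<close>, the squared feature distance is a difference of two values of
  \<open>K\<close>, to which the mean value bound applies. The witness \<open>r\<close> has exponent
  \<open>- N\<close> and no factor \<open>sqrt 2\<close>; that missing factor gives the strict
  inequality.\<close>

lemma taylor_case:
  fixes X :: "'a::metric_space set"
  assumes X: "bounded X" "range xs \<subseteq> X" "q > 1" and D: "D = diameter X" "D > 0"
    and "taylor_kernel D (W_set X q xs N) K kW
      \<and> \<rho> = q powr (- real N / 2) * D * sqrt (2 * max_abs_deriv (taylor_interval D) K)"
  obtains r B where "0 \<le> r" "r < \<rho>" "psd_on (W_set X q xs N) kW"
    "\<And>w. w \<in> W_set X q xs N \<Longrightarrow> kW w w \<le> B"
    "\<And>x. x \<in> X \<Longrightarrow> kW (phi q xs x) (phi q xs x)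
      - 2 * kW (phi q xs x) (pad N (phi_trunc q xs N x))
      + kW (pad N (phi_trunc q xs N x)) (pad N (phi_trunc q xs N x)) \<le> r\<^sup>2"
proof (rule that)
  let ?W = "W_set X q xs N" and ?C = "max_abs_deriv (taylor_interval D) K"
  have ker: "taylor_kernel D ?W K kW"
    and \<rho>: "\<rho> = q powr (- real N / 2) * D * sqrt (2 * ?C)" using assms(6) by auto
  have kW: "kW u v = K (ell2_inner u v)" if "u \<in> ?W" "v \<in> ?W" for u v
    using ker that by (simp add: taylor_kernel_def)
  have C: "0 < ?C" by (rule taylor_deriv_pos[OF ker D(2)])
  have W2: "?W \<subseteq> ell2" by (rule W_set_subset_ell2[OF X])
  have WD: "ell2_inner w w \<le> D\<^sup>2" if "w \<in> ?W" for w
    using W_set_inner_le[OF X that] by (simp add: D)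
  have I: "ell2_inner w w \<in> taylor_interval D" if "w \<in> ?W" for w
  proof -
    have "0 \<le> ell2_inner w w" using W2 that by (intro ell2_inner_self_nonneg) auto
    then show ?thesis using WD[OF that] by simp
  qed
  have Lip: "\<bar>K s - K t\<bar> \<le> ?C * \<bar>s - t\<bar>" if "s \<in> taylor_interval D" "t \<in> taylor_interval D" for s t
    using C1_on_Lipschitz[OF _ that] ker by (simp add: taylor_kernel_def)
  show "psd_on ?W kW" by (rule taylor_psd[OF ker W2 WD])
  let ?r = "q powr (- real N) * D * sqrt ?C"
  show "0 \<le> ?r" using C D(2) by simp
  have "?r \<le> q powr (- real N / 2) * D * sqrt ?C"
    using C D(2) X(3) by (intro mult_right_mono powr_mono) auto
  also have "\<dots> < \<rho>"
    unfolding \<rho> using C D(2) X(3) by (intro mult_strict_left_mono) auto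
  finally show "?r < \<rho>" .
  \<comment> \<open>The diagonal bound is the mean value bound started at 0.\<close>
  show "kW w w \<le> K 0 + ?C * D\<^sup>2" if "w \<in> ?W" for w
  proof -
    have "0 \<in> taylor_interval D" by simp
    then have "K (ell2_inner w w) - K 0 \<le> ?C * \<bar>ell2_inner w w\<bar>"
      using Lip[OF I[OF that], of 0] by simp
    also have "\<dots> \<le> ?C * D\<^sup>2"
    proof (rule mult_left_mono)
      show "\<bar>ell2_inner w w\<bar> \<le> D\<^sup>2"
        using WD[OF that] ell2_inner_self_nonneg[of w] W2 that by auto
    qed (use C in simp)
    finally show ?thesis by (simp add: kW[OF that that])
  qed
  fix x assume x: "x \<in> X"
  let ?u = "phi q xs x" and ?v = "pad N (phi_trunc q xs N x)"
  have uv: "?u \<in> ?W" "?v \<in> ?W" using x by (auto simp: W_set_def)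
  note tr = phi_truncation(1-3)[OF X x, of N]
  have "kW ?u ?u - 2 * kW ?u ?v + kW ?v ?v = K (ell2_inner ?u ?u) - K (ell2_inner ?v ?v)"
    using uv by (simp add: kW tr(1))
  also have "\<dots> \<le> ?C * \<bar>ell2_inner ?u ?u - ell2_inner ?v ?v\<bar>"
    using Lip[OF I[OF uv(1)] I[OF uv(2)]] by linarith
  also have "\<dots> \<le> ?C * (D / q ^ N)\<^sup>2"
    using tr(2,3) C by (intro mult_left_mono) (auto simp: D)
  also have "\<dots> = ?r\<^sup>2"
    using X(3) C by (simp add: powr_minus powr_realpow power_mult_distrib field_simps)
  finally show "kW ?u ?u - 2 * kW ?u ?v + kW ?v ?v \<le> ?r\<^sup>2" .
qed

text \<open>The diagonal of the kernel is constantly \<open>K 0\<close>, so the squared feature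
  distance is twice the decrease of \<open>K\<close> from 0 to the squared distance of the features.
  Strict decrease bounds this strictly by \<open>\<rho>\<^sup>2\<close>.\<close>

lemma radial_case:
  fixes X :: "'a::metric_space set"
  assumes X: "bounded X" "range xs \<subseteq> X" "q > 1" and D: "D = diameter X" "D > 0"
    and "radial_kernel D (W_set X q xs N) K kW
      \<and> \<rho> = q powr (- real N) * D * sqrt (2 * max_abs_deriv (radial_interval D) K)"
  obtains r B where "0 \<le> r" "r < \<rho>" "psd_on (W_set X q xs N) kW"
    "\<And>w. w \<in> W_set X q xs N \<Longrightarrow> kW w w \<le> B"
    "\<And>x. x \<in> X \<Longrightarrow> kW (phi q xs x) (phi q xs x)
      - 2 * kW (phi q xs x) (pad N (phi_trunc q xs N x))
      + kW (pad N (phi_trunc q xs N x)) (pad N (phi_trunc q xs N x)) \<le> r\<^sup>2"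
proof (rule that)
  let ?W = "W_set X q xs N" and ?C = "max_abs_deriv (radial_interval D) K"
  have ker: "radial_kernel D ?W K kW"
    and \<rho>: "\<rho> = q powr (- real N) * D * sqrt (2 * ?C)" using assms(6) by auto
  have W2: "?W \<subseteq> ell2" by (rule W_set_subset_ell2[OF X])
  have kW: "kW u v = K (ell2_inner u u - 2 * ell2_inner u v + ell2_inner v v)"
    if "u \<in> ?W" "v \<in> ?W" for u v
  proof -
    have "kW u v = K ((ell2_norm (\<lambda>n. u n - v n))\<^sup>2)"
      using ker that unfolding radial_kernel_def by blast
    moreover have "u \<in> ell2" "v \<in> ell2" using W2 that by blast+
    ultimately show ?thesis by (simp only: ell2_norm_diff(1))
  qed
  show "psd_on ?W kW" by (rule radial_psd[OF ker W2])
  \<comment> \<open>The uniform bound on the squared distance between a feature and its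
    truncation.\<close>
  let ?t = "(D / q ^ N)\<^sup>2"
  let ?r = "sqrt (2 * (K 0 - K ?t))"
  have t: "0 < ?t" "?t \<le> 4 * D\<^sup>2"
  proof -
    show "0 < ?t" using D(2) X(3) by simp
    have "1 \<le> (q ^ N)\<^sup>2" using X(3) by (intro one_le_power) auto
    then have "D\<^sup>2 / (q ^ N)\<^sup>2 \<le> D\<^sup>2 / 1" using X(3) by (intro divide_left_mono) auto
    then show "?t \<le> 4 * D\<^sup>2" using zero_le_power2[of D] unfolding power_divide by linarith
  qed
  have K0: "0 \<le> K 0 - K ?t" using radial_antimono[OF ker order_refl, of ?t] by simp
  then show "0 \<le> ?r" by simp
  have "?r < sqrt (2 * (?C * ?t))"
    using radial_strict_decrease[OF ker t] by (intro real_sqrt_less_mono) simp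
  also have "\<dots> = \<rho>"
    using X(3) D(2) unfolding \<rho>
    by (simp add: real_sqrt_mult real_sqrt_divide powr_minus powr_realpow field_simps)
  finally show "?r < \<rho>" .
  show "kW w w \<le> K 0" if "w \<in> ?W" for w by (simp add: kW[OF that that])
  fix x assume x: "x \<in> X"
  let ?u = "phi q xs x" and ?v = "pad N (phi_trunc q xs N x)"
  have uv: "?u \<in> ?W" "?v \<in> ?W" using x by (auto simp: W_set_def)
  note tr = phi_truncation(1-3)[OF X x, of N]
  have "kW ?u ?u - 2 * kW ?u ?v + kW ?v ?v
      = 2 * (K 0 - K (ell2_inner ?u ?u - ell2_inner ?v ?v))"
    using uv by (simp add: kW tr(1))
  also have "\<dots> \<le> 2 * (K 0 - K ?t)"
    using radial_antimono[OF ker, of "ell2_inner ?u ?u - ell2_inner ?v ?v" ?t] tr(2,3)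
    by (simp add: D)
  also have "\<dots> = ?r\<^sup>2" using K0 by simp
  finally show "kW ?u ?u - 2 * kW ?u ?v + kW ?v ?v \<le> ?r\<^sup>2" .
qed

section \<open>Assembling the estimate\<close>

theorem theorem17:
  fixes X :: "'a::metric_space set"
    and xs :: "nat \<Rightarrow> 'a"
    and N :: nat
    and q \<epsilon> D \<rho>\<^sub>t :: real
    and K :: "real \<Rightarrow> real"
    and kW :: "(nat \<Rightarrow> real) \<Rightarrow> (nat \<Rightarrow> real) \<Rightarrow> real"
    and k k\<^sub>t :: "'a \<Rightarrow> 'a \<Rightarrow> real"
    and H H\<^sub>t :: "('a \<Rightarrow> real) set"
    and ip ip\<^sub>t :: "('a \<Rightarrow> real) \<Rightarrow> ('a \<Rightarrow> real) \<Rightarrow> real"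
    and f h :: "'a \<Rightarrow> real"
  assumes "compact X" and "X \<noteq> {}"
    and "D = diameter X" and "D > 0"
    and "is_basis X xs"
    and "N \<ge> 2" and "q > 1"
    and "taylor_kernel D (W_set X q xs N) K kW
           \<and> \<rho>\<^sub>t = q powr (- real N / 2) * D * sqrt (2 * max_abs_deriv (taylor_interval D) K)
         \<or> radial_kernel D (W_set X q xs N) K kW
           \<and> \<rho>\<^sub>t = q powr (- real N) * D * sqrt (2 * max_abs_deriv (radial_interval D) K)"
    and "\<forall>x\<in>X. \<forall>y\<in>X. k x y = kW (phi q xs x) (phi q xs y)"
    and "\<forall>x\<in>X. \<forall>y\<in>X. k\<^sub>t x y = kW (pad N (phi_trunc q xs N x)) (pad N (phi_trunc q xs N y))"
    and "is_RKHS X k H ip"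
    and "is_RKHS X k\<^sub>t H\<^sub>t ip\<^sub>t"
    and "\<epsilon> > 0"
    and "continuous_on X f"
    and "is_arg_min (\<lambda>g. (hs_norm ip g)\<^sup>2)
           (\<lambda>g. g \<in> H \<and> sup_norm X (\<lambda>x. g x - f x) \<le> \<epsilon>) h"
  shows "\<exists>h\<^sub>t\<in>H\<^sub>t. sup_norm X (\<lambda>x. f x - h\<^sub>t x) \<le> \<epsilon> + \<rho>\<^sub>t * hs_norm ip h"
proof -
  let ?W = "W_set X q xs N" and ?\<phi> = "phi q xs" and ?\<psi> = "\<lambda>x. pad N (phi_trunc q xs N x)"
  let ?n = "hs_norm ip h"
  note comp = assms(1) and ne = assms(2) and D = assms(3) and Dpos = assms(4) and q = assms(7)
    and rk = assms(11) and rk' = assms(12)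
  have bX: "bounded X" by (rule compact_imp_bounded[OF comp])
  have xs: "range xs \<subseteq> X" using assms(5) by (simp add: is_basis_def)
  have \<phi>: "?\<phi> ` X \<subseteq> ?W" and \<psi>: "?\<psi> ` X \<subseteq> ?W" by (auto simp: W_set_def)
  have h: "h \<in> H" "sup_norm X (\<lambda>x. h x - f x) \<le> \<epsilon>"
    using assms(15) by (auto simp: is_arg_min_def)
  have n0: "0 \<le> ?n" by (rule hs_norm_nonneg(1)[OF rk h(1)])
  obtain r B where r: "0 \<le> r" "r < \<rho>\<^sub>t" and psd: "psd_on ?W kW"
    and diag: "\<And>w. w \<in> ?W \<Longrightarrow> kW w w \<le> B"
    and close: "\<And>x. x \<in> X \<Longrightarrow>
      kW (?\<phi> x) (?\<phi> x) - 2 * kW (?\<phi> x) (?\<psi> x) + kW (?\<psi> x) (?\<psi> x) \<le> r\<^sup>2"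
    using assms(8)
  proof
    assume "taylor_kernel D ?W K kW
      \<and> \<rho>\<^sub>t = q powr (- real N / 2) * D * sqrt (2 * max_abs_deriv (taylor_interval D) K)"
    then show thesis
      using taylor_case[OF bX xs q D Dpos] that by blast
  next
    assume "radial_kernel D ?W K kW
      \<and> \<rho>\<^sub>t = q powr (- real N) * D * sqrt (2 * max_abs_deriv (radial_interval D) K)"
    then show thesis
      using radial_case[OF bX xs q D Dpos] that by blast
  qed
  \<comment> \<open>The absolute value allows for a bound \<open>B\<close> of unknown sign.\<close>
  define \<kappa> where "\<kappa> = sqrt \<bar>B\<bar>"
  have \<kappa>: "0 \<le> \<kappa>" "\<And>w. w \<in> ?W \<Longrightarrow> kW w w \<le> \<kappa>\<^sup>2"
    using diag order_trans[OF _ abs_ge_self[of B]] by (auto simp: \<kappa>_def)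
  have hb: "\<bar>h x\<bar> \<le> ?n * \<kappa>" if x: "x \<in> X" for x
  proof -
    have "k x x \<le> \<kappa>\<^sup>2" using assms(9) \<kappa>(2)[of "?\<phi> x"] \<phi> x by auto
    then have "sqrt (k x x) \<le> \<kappa>" using \<kappa>(1) by (simp add: real_le_lsqrt)
    then have "?n * sqrt (k x x) \<le> ?n * \<kappa>" by (rule mult_left_mono[OF _ n0])
    then show ?thesis using RKHS_pointwise_bound[OF rk x h(1)] by linarith
  qed
  obtain b where b: "\<And>x. x \<in> X \<Longrightarrow> \<bar>f x\<bar> \<le> b"
    using compact_imp_bounded[OF compact_continuous_image[OF assms(14) comp]]
    unfolding bounded_iff by auto
  \<comment> \<open>Only for a bounded family does the bound on the supremum give pointwise bounds;
    \<open>h\<close> is bounded by the reproducing property and \<open>f\<close> by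
    compactness.\<close>
  have bdd: "bdd_above ((\<lambda>x. \<bar>h x - f x\<bar>) ` X)"
  proof (rule bdd_aboveI2)
    show "\<bar>h x - f x\<bar> \<le> ?n * \<kappa> + b" if "x \<in> X" for x
      using hb[OF that] b[OF that] by linarith
  qed
  have hf: "\<bar>f x - h x\<bar> \<le> \<epsilon>" if "x \<in> X" for x
    using cSUP_upper[OF that bdd] h(2) by (simp add: sup_norm_def abs_minus_commute)
  have "\<exists>g\<in>H\<^sub>t. \<forall>x\<in>X. \<bar>h x - g x\<bar> \<le> \<rho>\<^sub>t * ?n"
  \<comment> \<open>The slack \<open>(\<rho>\<^sub>t - r) * ?n\<close> that serves as
    \<open>\<eta>\<close> is positive only for a nonzero norm. If the norm is zero, \<open>h\<close>
    vanishes on \<open>X\<close> and the zero function does.\<close>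
  proof (cases "?n = 0")
    case True
    have "(\<lambda>x\<in>X. 0) \<in> H\<^sub>t" using rk' unfolding is_RKHS_def function_hilbert_space_def by blast
    then show ?thesis using hb True by (intro bexI[of _ "\<lambda>x\<in>X. 0"]) auto
  next
    case False
    then have "0 < (\<rho>\<^sub>t - r) * ?n" using n0 r by simp
    then have "\<exists>g\<in>H\<^sub>t. \<forall>x\<in>X. \<bar>h x - g x\<bar> \<le> r * ?n + (\<rho>\<^sub>t - r) * ?n"
      by (intro RKHS_transfer[where kW = kW and \<phi> = ?\<phi> and \<psi> = ?\<psi>,
            OF psd \<phi> \<psi> assms(9,10) rk rk' h(1) r(1) \<kappa>(1) _ \<kappa>(2) close])
    then show ?thesis by (simp add: algebra_simps)
  qed
  then obtain g where g: "g \<in> H\<^sub>t" "\<And>x. x \<in> X \<Longrightarrow> \<bar>h x - g x\<bar> \<le> \<rho>\<^sub>t * ?n" by blast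
  have "sup_norm X (\<lambda>x. f x - g x) \<le> \<epsilon> + \<rho>\<^sub>t * ?n"
    unfolding sup_norm_def
  proof (rule cSUP_least[OF ne])
    show "\<bar>f x - g x\<bar> \<le> \<epsilon> + \<rho>\<^sub>t * ?n" if "x \<in> X" for x
      using hf[OF that] g(2)[OF that] by linarith
  qed
  with g(1) show ?thesis by blast
qed

end
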